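(* Let $\mathcal{G}=(V,\mathcal{E})$ be a finite simple planar graph with a fixed planar embedding, carrying a binary Markov random field with arbitrary real pairwise parameters $(\theta_{ij})_{\{i,j\}\in \mathcal{E}}$ and arbitrary real unary parameters $(\theta_i)_{i\in V}$. Then the best lower bound achieved by any outer-planar decomposition is no larger than $E_{PCC}$. That is, for every finite collection $(G_t)_{t\in T}$ of outer-planar subgraphs $G_t=(V_t,\mathcal{E}_t)$ of $\mathcal{G}$, and all real parameters $\theta^t=\big((\theta^t_{ij})_{\{i,j\}\in \mathcal{E}_t},(\theta^t_i)_{i\in V_t}\big)$, $t\in T$, satisfying $\sum_{t:\{i,j\}\in \mathcal{E}_t}\theta^t_{ij}=\theta_{ij}$ for every $\{i,j\}\in \mathcal{E}$ and $\sum_{t:i\in V_t}\theta^t_i=\theta_i$ for every $i\in V$, one has $$\sum_{t\in T}\ \min_{X^t\in\{0,1\}^{V_t}}\Big(\sum_{\{i,j\}\in \mathcal{E}_t}\theta^t_{ij}[X^t_i\neq X^t_j]+\sum_{i\in V_t}\theta^t_i[X^t_i\neq 0]\Big)\ \le\ E_{PCC}.$$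
   Context: $[\cdot]$ denotes the indicator function. The energy of the Markov random field on $\mathcal{G}$ is $E(X,\theta)=\sum_{\{i,j\}\in \mathcal{E}}\theta_{ij}[X_i\neq X_j]+\sum_{i\in V}\theta_i[X_i\neq 0]$ for $X\in\{0,1\}^V$. A graph is outer-planar if it has a planar embedding in which all vertices lie on the boundary of a common face. An outer-planar decomposition is a collection of outer-planar subgraphs of $\mathcal{G}$ with parameters summing to the original parameters; its lower bound is the sum of the independently minimized subproblem energies, and the best lower bound is obtained by maximizing over the parameters. Planar cycle covering bound. Let $F$ be the set of faces of the planar embedding of $\mathcal{G}$ (including the exterior face), and for $i\in V$ let $N_i\subseteq F$ be the set of faces whose boundary contains $i$. For each face $f$ introduce an auxiliary binary variable $X_0^f\in\{0,1\}$, connected to each vertex $i$ on the boundary of $f$ with a weight $\theta_i^f\in\mathbb{R}$. Then $$E_{PCC}=\max_{\{\theta_i^f\}:\ \sum_{f\in N_i}\theta_i^f=\theta_i\ \forall i\in V}\ \ \min_{X\in\{0,1\}^V,\ (X_0^f)\in\{0,1\}^F}\ \sum_{\{i,j\}\in \mathcal{E}}\theta_{ij}[X_i\neq X_j]+\sum_{i\in V}\sum_{f\in N_i}\theta_i^f[X_i\neq X_0^f].$$ The variables $X_0^f$ for different faces are minimized over independently. *)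

theory Defs
  imports "HOL-Analysis.Analysis"
begin

text \<open>A simple graph is given by its vertex set and a set of two-element sets of vertices.\<close>

definition simple_graph :: "'v set \<Rightarrow> 'v set set \<Rightarrow> bool" where
  "simple_graph V E \<longleftrightarrow> (\<forall>e\<in>E. e \<subseteq> V \<and> card e = 2)"

definition subgraph :: "'v set \<Rightarrow> 'v set set \<Rightarrow> 'v set \<Rightarrow> 'v set set \<Rightarrow> bool" where
  "subgraph V' E' V E \<longleftrightarrow> simple_graph V' E' \<and> V' \<subseteq> V \<and> E' \<subseteq> E"

text \<open>Vertices are drawn as distinct points of the plane and edges as (topological) arcs
  joining the images of their endpoints; an arc passes through no other vertex, and two
  arcs meet only in the images of common endpoints.\<close>

definition planar_embedding ::
    "'v set \<Rightarrow> 'v set set \<Rightarrow> ('v \<Rightarrow> complex) \<Rightarrow> ('v set \<Rightarrow> real \<Rightarrow> complex) \<Rightarrow> bool" where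
  "planar_embedding V E \<phi> \<gamma> \<longleftrightarrow>
     inj_on \<phi> V \<and>
     (\<forall>e\<in>E. arc (\<gamma> e) \<and> {pathstart (\<gamma> e), pathfinish (\<gamma> e)} = \<phi> ` e \<and>
             path_image (\<gamma> e) \<inter> \<phi> ` V = \<phi> ` e) \<and>
     (\<forall>e\<in>E. \<forall>e'\<in>E. e \<noteq> e' \<longrightarrow> path_image (\<gamma> e) \<inter> path_image (\<gamma> e') = \<phi> ` (e \<inter> e'))"

definition drawing ::
    "'v set \<Rightarrow> 'v set set \<Rightarrow> ('v \<Rightarrow> complex) \<Rightarrow> ('v set \<Rightarrow> real \<Rightarrow> complex) \<Rightarrow> complex set" where
  "drawing V E \<phi> \<gamma> = \<phi> ` V \<union> (\<Union>e\<in>E. path_image (\<gamma> e))"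

text \<open>The unbounded component, i.e. the exterior face, is included.\<close>

definition faces ::
    "'v set \<Rightarrow> 'v set set \<Rightarrow> ('v \<Rightarrow> complex) \<Rightarrow> ('v set \<Rightarrow> real \<Rightarrow> complex) \<Rightarrow> complex set set" where
  "faces V E \<phi> \<gamma> = components (- drawing V E \<phi> \<gamma>)"

definition incident_faces ::
    "'v set \<Rightarrow> 'v set set \<Rightarrow> ('v \<Rightarrow> complex) \<Rightarrow> ('v set \<Rightarrow> real \<Rightarrow> complex) \<Rightarrow> 'v \<Rightarrow> complex set set" where
  "incident_faces V E \<phi> \<gamma> i = {f \<in> faces V E \<phi> \<gamma>. \<phi> i \<in> frontier f}"

definition outer_planar :: "'v set \<Rightarrow> 'v set set \<Rightarrow> bool" where
  "outer_planar V E \<longleftrightarrow>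
     (\<exists>\<phi> \<gamma>. planar_embedding V E \<phi> \<gamma> \<and>
        (\<exists>f \<in> faces V E \<phi> \<gamma>. \<forall>i\<in>V. \<phi> i \<in> frontier f))"

definition labelings :: "'a set \<Rightarrow> ('a \<Rightarrow> nat) set" where
  "labelings A = A \<rightarrow>\<^sub>E {0, 1}"

text \<open>For an edge \<open>e = {i, j}\<close> the condition \<open>\<exists>i\<in>e. \<exists>j\<in>e. X i \<noteq> X j\<close> says that its two
  endpoints are labelled differently.\<close>

definition pairwise_energy :: "'v set set \<Rightarrow> ('v set \<Rightarrow> real) \<Rightarrow> ('v \<Rightarrow> nat) \<Rightarrow> real" where
  "pairwise_energy E \<theta>E X = (\<Sum>e\<in>E. \<theta>E e * of_bool (\<exists>i\<in>e. \<exists>j\<in>e. X i \<noteq> X j))"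

definition energy ::
    "'v set \<Rightarrow> 'v set set \<Rightarrow> ('v set \<Rightarrow> real) \<Rightarrow> ('v \<Rightarrow> real) \<Rightarrow> ('v \<Rightarrow> nat) \<Rightarrow> real" where
  "energy V E \<theta>E \<theta>V X =
     pairwise_energy E \<theta>E X + (\<Sum>i\<in>V. \<theta>V i * of_bool (X i \<noteq> 0))"

definition min_energy ::
    "'v set \<Rightarrow> 'v set set \<Rightarrow> ('v set \<Rightarrow> real) \<Rightarrow> ('v \<Rightarrow> real) \<Rightarrow> real" where
  "min_energy V E \<theta>E \<theta>V = Min (energy V E \<theta>E \<theta>V ` labelings V)"

text \<open>The parameter \<open>\<theta>F i f\<close> is the weight of the edge between the vertex \<open>i\<close> and the
  auxiliary variable of the face \<open>f\<close>; only its values for \<open>f\<close> incident to \<open>i\<close> matter.\<close>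

definition pcc_energy ::
    "'v set \<Rightarrow> 'v set set \<Rightarrow> ('v \<Rightarrow> complex) \<Rightarrow> ('v set \<Rightarrow> real \<Rightarrow> complex) \<Rightarrow>
     ('v set \<Rightarrow> real) \<Rightarrow> ('v \<Rightarrow> complex set \<Rightarrow> real) \<Rightarrow>
     ('v \<Rightarrow> nat) \<Rightarrow> (complex set \<Rightarrow> nat) \<Rightarrow> real" where
  "pcc_energy V E \<phi> \<gamma> \<theta>E \<theta>F X X0 =
     pairwise_energy E \<theta>E X +
     (\<Sum>i\<in>V. \<Sum>f\<in>incident_faces V E \<phi> \<gamma> i. \<theta>F i f * of_bool (X i \<noteq> X0 f))"

definition pcc_min_energy ::
    "'v set \<Rightarrow> 'v set set \<Rightarrow> ('v \<Rightarrow> complex) \<Rightarrow> ('v set \<Rightarrow> real \<Rightarrow> complex) \<Rightarrow>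
     ('v set \<Rightarrow> real) \<Rightarrow> ('v \<Rightarrow> complex set \<Rightarrow> real) \<Rightarrow> real" where
  "pcc_min_energy V E \<phi> \<gamma> \<theta>E \<theta>F =
     Min ((\<lambda>(X, X0). pcc_energy V E \<phi> \<gamma> \<theta>E \<theta>F X X0) `
            (labelings V \<times> labelings (faces V E \<phi> \<gamma>)))"

definition pcc_feasible ::
    "'v set \<Rightarrow> 'v set set \<Rightarrow> ('v \<Rightarrow> complex) \<Rightarrow> ('v set \<Rightarrow> real \<Rightarrow> complex) \<Rightarrow>
     ('v \<Rightarrow> real) \<Rightarrow> ('v \<Rightarrow> complex set \<Rightarrow> real) \<Rightarrow> bool" where
  "pcc_feasible V E \<phi> \<gamma> \<theta>V \<theta>F \<longleftrightarrow>
     (\<forall>i\<in>V. (\<Sum>f\<in>incident_faces V E \<phi> \<gamma> i. \<theta>F i f) = \<theta>V i)"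

text \<open>The maximum is taken literally, as the greatest attained value, not as a supremum.\<close>

definition pcc_bound ::
    "'v set \<Rightarrow> 'v set set \<Rightarrow> ('v \<Rightarrow> complex) \<Rightarrow> ('v set \<Rightarrow> real \<Rightarrow> complex) \<Rightarrow>
     ('v set \<Rightarrow> real) \<Rightarrow> ('v \<Rightarrow> real) \<Rightarrow> real" where
  "pcc_bound V E \<phi> \<gamma> \<theta>E \<theta>V =
     (GREATEST z. \<exists>\<theta>F. pcc_feasible V E \<phi> \<gamma> \<theta>V \<theta>F \<and> z = pcc_min_energy V E \<phi> \<gamma> \<theta>E \<theta>F)"

end

theory Submission
  imports Defs "HOL-Complex_Analysis.Winding_Numbers"
begin

text \<open>By linear programming duality, \<open>E\<^sub>P\<^sub>C\<^sub>C\<close> is the least expected energy \<open>\<Sum> \<theta>\<^sub>i\<^sub>j d\<^sub>i\<^sub>j + \<Sum> \<theta>\<^sub>i m\<^sub>i\<close> of a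
  probability distribution on the labelings of the vertices and faces for which the probability
  \<open>m\<^sub>i\<close> of \<open>X\<^sub>i \<noteq> X\<^sub>0\<^sup>f\<close> does not depend on the face \<open>f\<close> at \<open>i\<close>; here \<open>d\<^sub>i\<^sub>j\<close> is the probability of
  \<open>X\<^sub>i \<noteq> X\<^sub>j\<close>. Since adjacent vertices lie on a common face, the \<open>d\<^sub>i\<^sub>j\<close> along edges and the \<open>m\<^sub>i\<close>
  satisfy the triangle inequalities of a metric on \<open>V\<close> extended by one apex, and clamping the
  remaining \<open>d\<^sub>i\<^sub>j\<close> gives such a metric on all pairs. An outer-planar graph can be dismantled by
  successively removing a vertex of degree at most two and joining its neighbours: otherwise it
  would contain a subdivision of the complete graph on four vertices, which cannot be drawn with all
  four branch points on one face. On four points (the removed vertex, its neighbours and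
  the apex) the triangle inequalities describe the cut polytope, so by induction the minimal energy of
  every outer-planar subproblem is at most its expected energy under \<open>d\<close> and \<open>m\<close>. Summing over the
  subproblems gives the claim.\<close>

subsection \<open>Linear programming duality\<close>

text \<open>The outer-planar pieces come with drawings of their own, unrelated to the embedding of
  the whole graph, so the two sides communicate only through \<open>D\<close> and \<open>m\<close>.
  Removing a vertex may join two neighbours that are not adjacent in the whole graph, hence
  \<open>D\<close> is needed on all pairs. Such a pair need not share a face; its cut probability
  can then violate the inequalities with the apex, and this is what the clamping repairs. On edges
  the clamping must change nothing, because there the cost sees \<open>D\<close>; this is why
  adjacent vertices have to share a face. Degree two is the limit of the elimination for two
  reasons: a function of two binary labels is always a constant plus unary terms plus one edge term,
  which fails for three labels, and the triangle inequalities describe the cut polytope on four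
  points but not on five.\<close>

definition prob_weights :: "'s set \<Rightarrow> ('s \<Rightarrow> real) \<Rightarrow> bool" where
  "prob_weights S w \<longleftrightarrow> (\<forall>s\<in>S. 0 \<le> w s) \<and> sum w S = 1"

definition expect :: "'s set \<Rightarrow> ('s \<Rightarrow> real) \<Rightarrow> ('s \<Rightarrow> real) \<Rightarrow> real" where
  "expect S w f = (\<Sum>s\<in>S. w s * f s)"

lemma expect_add: "expect S w (\<lambda>s. f s + g s) = expect S w f + expect S w g"
  by (simp add: expect_def sum.distrib algebra_simps)

lemma expect_diff: "expect S w (\<lambda>s. f s - g s) = expect S w f - expect S w g"
  by (simp add: expect_def sum_subtractf algebra_simps)

lemma expect_cmult: "expect S w (\<lambda>s. a * f s) = a * expect S w f"
  by (simp add: expect_def sum_distrib_left algebra_simps)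

lemma expect_const: "prob_weights S w \<Longrightarrow> expect S w (\<lambda>s. a) = a"
  by (simp add: expect_def prob_weights_def flip: sum_distrib_right)

lemma expect_sum: "expect S w (\<lambda>s. \<Sum>i\<in>I. f i s) = (\<Sum>i\<in>I. expect S w (f i))"
  unfolding expect_def by (simp add: sum_distrib_left, rule sum.swap)

lemma expect_mono:
  "prob_weights S w \<Longrightarrow> (\<And>s. s \<in> S \<Longrightarrow> f s \<le> g s) \<Longrightarrow> expect S w f \<le> expect S w g"
  unfolding expect_def prob_weights_def by (intro sum_mono mult_left_mono) auto

lemma expect_combine:
  "expect S (\<lambda>s. a * w s + b * w' s) f = a * expect S w f + b * expect S w' f"
  by (simp add: expect_def sum.distrib sum_distrib_left algebra_simps)

lemma prob_weights_combine:
  assumes "prob_weights S w" "prob_weights S w'" "0 \<le> a" "0 \<le> b" "a + b = 1"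
  shows "prob_weights S (\<lambda>s. a * w s + b * w' s)"
  using assms by (simp add: prob_weights_def sum.distrib flip: sum_distrib_left)

text \<open>The elementary core of Fourier-Motzkin elimination: it yields the multiplier in
  \<open>lp_duality_step\<close> and the free parameter in
  \<open>cut_metric_four_points\<close>.\<close>

lemma separating_number:
  fixes L U :: "real set"
  assumes "finite L" "finite U" "\<And>l u. l \<in> L \<Longrightarrow> u \<in> U \<Longrightarrow> l \<le> u"
  shows "\<exists>x. (\<forall>l\<in>L. l \<le> x) \<and> (\<forall>u\<in>U. x \<le> u)"
proof (cases "L = {}")
  case True
  then show ?thesis
    using assms by (cases "U = {}") (auto intro!: exI[of _ "Min U"])
next
  case False
  then show ?thesis
    using assms by (intro exI[of _ "Max L"]) auto
qed

text \<open>Constraints are traded for multipliers one at a time. \<open>I\<close> holds the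
  constraints that members of \<open>W\<close> may still violate. To remove \<open>i\<close>,
  members with positive and negative expectation of \<open>g i\<close> are mixed pairwise so that
  this expectation vanishes; the multipliers found for the mixtures then leave room for a multiplier
  of \<open>g i\<close> itself.\<close>

lemma lp_duality_step:
  assumes "finite I" "I \<subseteq> J"
    and H: "\<And>w. prob_weights S w \<Longrightarrow> \<forall>i\<in>J. expect S w (g i) = 0 \<Longrightarrow> z \<le> expect S w c"
    and "finite W" "\<And>w. w \<in> W \<Longrightarrow> prob_weights S w"
    and "\<And>w i. w \<in> W \<Longrightarrow> i \<in> J - I \<Longrightarrow> expect S w (g i) = 0"
  shows "\<exists>l. \<forall>w\<in>W. z \<le> expect S w c + (\<Sum>i\<in>I. l i * expect S w (g i))"
  using assms(1,2,4-)
proof (induction I arbitrary: W rule: finite_induct)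
  case empty
  then show ?case using H by auto
next
  case (insert i I)
  define G where "G w = expect S w (g i)" for w
  \<comment> \<open>For \<open>G n < 0 < G p\<close> this is the convex combination of
    \<open>p\<close> and \<open>n\<close> under which the expectation of \<open>g i\<close> is
    zero.\<close>
  define comb where "comb p n = (\<lambda>s. (- G n / (G p - G n)) * p s + (G p / (G p - G n)) * n s)" for p n
  define P where "P = {w \<in> W. G w > 0}"
  define N where "N = {w \<in> W. G w < 0}"
  define Z where "Z = {w \<in> W. G w = 0}"
  define W' where "W' = Z \<union> (\<lambda>(p, n). comb p n) ` (P \<times> N)"
  have fin: "finite P" "finite N" "finite Z"
    using insert.prems by (auto simp: P_def N_def Z_def)
  have comb: "expect S (comb p n) f = (- G n / (G p - G n)) * expect S p f + (G p / (G p - G n)) * expect S n f"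
    for p n f
    unfolding comb_def by (rule expect_combine)
  have "\<exists>l. \<forall>w\<in>W'. z \<le> expect S w c + (\<Sum>i\<in>I. l i * expect S w (g i))"
  proof (rule insert.IH)
    show "finite W'" using fin by (simp add: W'_def)
    show "prob_weights S w" if "w \<in> W'" for w
    proof -
      have "prob_weights S (comb p n)" if "p \<in> P" "n \<in> N" for p n
        unfolding comb_def
        using that insert.prems(3)
        by (intro prob_weights_combine) (auto simp: P_def N_def divide_simps)
      then show ?thesis
        using that insert.prems(3) by (auto simp: W'_def Z_def)
    qed
    show "expect S w (g j) = 0" if "w \<in> W'" "j \<in> J - I" for w j
    proof (cases "j = i")
      case True
      have "expect S (comb p n) (g i) = (- G n / (G p - G n)) * G p + (G p / (G p - G n)) * G n" for p n
        unfolding comb G_def ..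
      then have "expect S (comb p n) (g i) = 0" for p n
        by (simp add: divide_simps)
      then show ?thesis
        using that True by (auto simp: W'_def Z_def G_def)
    next
      case False
      then have "j \<in> J - insert i I" using that by auto
      then have "\<And>w. w \<in> W \<Longrightarrow> expect S w (g j) = 0"
        using insert.prems(4) by blast
      then show ?thesis
        using that(1) by (auto simp: W'_def Z_def P_def N_def comb)
    qed
  qed (use insert.prems in auto)
  then obtain l where l: "\<And>w. w \<in> W' \<Longrightarrow> z \<le> expect S w c + (\<Sum>i\<in>I. l i * expect S w (g i))"
    by blast
  define h where "h w = expect S w c + (\<Sum>i\<in>I. l i * expect S w (g i))" for w
  have h_comb: "h (comb p n) = (- G n / (G p - G n)) * h p + (G p / (G p - G n)) * h n" for p n
    unfolding h_def comb by (simp add: algebra_simps sum.distrib sum_distrib_left sum_subtractf sum_negf)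
  \<comment> \<open>Each \<open>p\<close> bounds the new multiplier from below and each
    \<open>n\<close> from above; the bounds are compatible because
    \<open>z \<le> h (comb p n)\<close>.\<close>
  have "\<exists>x. (\<forall>a\<in>(\<lambda>p. (z - h p) / G p) ` P. a \<le> x) \<and> (\<forall>b\<in>(\<lambda>n. (z - h n) / G n) ` N. x \<le> b)"
  proof (rule separating_number)
    fix a b assume "a \<in> (\<lambda>p. (z - h p) / G p) ` P" "b \<in> (\<lambda>n. (z - h n) / G n) ` N"
    then obtain p n where pn: "p \<in> P" "n \<in> N" "a = (z - h p) / G p" "b = (z - h n) / G n"
      by auto
    then have "comb p n \<in> W'" by (auto simp: W'_def)
    from l[OF this] have "z \<le> h (comb p n)" by (simp add: h_def)
    moreover have sg: "G p > 0" "G n < 0" using pn by (auto simp: P_def N_def)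
    ultimately have "z * (G p - G n) \<le> - G n * h p + G p * h n"
      unfolding h_comb by (simp add: divide_simps)
    then have "((z - h p) * G n - (z - h n) * G p) / (G p * G n) \<le> 0"
      using sg by (intro divide_nonneg_neg mult_pos_neg) (auto simp: algebra_simps)
    moreover have "a - b = ((z - h p) * G n - (z - h n) * G p) / (G p * G n)"
      using sg pn by (simp add: diff_frac_eq)
    ultimately show "a \<le> b" by simp
  qed (use fin in auto)
  then obtain x where x: "\<And>p. p \<in> P \<Longrightarrow> (z - h p) / G p \<le> x" "\<And>n. n \<in> N \<Longrightarrow> x \<le> (z - h n) / G n"
    by auto
  have main: "z \<le> h w + x * G w" if "w \<in> W" for w
  proof -
    consider "w \<in> P" | "w \<in> N" | "w \<in> Z" using \<open>w \<in> W\<close> linorder_less_linear[of "G w" 0] unfolding P_def N_def Z_def by blast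
    then show ?thesis
    proof cases
      case 1 then show ?thesis using x(1)[of w] by (simp add: P_def divide_simps split: if_splits)
    next
      case 2 then show ?thesis using x(2)[of w] by (simp add: N_def divide_simps split: if_splits)
    next
      case 3
      then have "w \<in> W'" by (simp add: W'_def)
      from l[OF this] show ?thesis using 3 by (simp add: h_def Z_def)
    qed
  qed
  have "(\<Sum>k\<in>insert i I. (l(i := x)) k * expect S w (g k)) = x * G w + (\<Sum>k\<in>I. l k * expect S w (g k))" for w
    using insert.hyps by (auto simp: G_def intro!: sum.cong)
  then show ?case
    using main by (intro exI[of _ "l(i := x)"]) (auto simp: h_def algebra_simps)
qed

lemma lp_duality:
  assumes "finite S" "finite I"
    and "\<And>w. prob_weights S w \<Longrightarrow> \<forall>i\<in>I. expect S w (g i) = 0 \<Longrightarrow> z \<le> expect S w c"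
  shows "\<exists>l. \<forall>s\<in>S. z \<le> c s + (\<Sum>i\<in>I. l i * g i s)"
proof -
  \<comment> \<open>Point masses turn the statement on weights into one on single elements of
    \<open>S\<close>.\<close>
  define \<delta> :: "'a \<Rightarrow> 'a \<Rightarrow> real" where "\<delta> s = (\<lambda>t. of_bool (t = s))" for s
  have E: "expect S (\<delta> s) f = f s" if "s \<in> S" for s f
  proof -
    have "expect S (\<delta> s) f = (\<Sum>t\<in>S. if t = s then f t else 0)"
      unfolding expect_def \<delta>_def by (rule sum.cong) auto
    then show ?thesis using that assms(1) by simp
  qed
  have "\<exists>l. \<forall>w\<in>\<delta> ` S. z \<le> expect S w c + (\<Sum>i\<in>I. l i * expect S w (g i))"
  proof (rule lp_duality_step[where J = I])
    show "prob_weights S w" if "w \<in> \<delta> ` S" for w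
      using that assms(1) by (auto simp: prob_weights_def \<delta>_def of_bool_def cong: if_cong)
  qed (use assms in auto)
  then show ?thesis by (simp add: E)
qed

subsection \<open>Drawings of the complete graph on four vertices\<close>

text \<open>Arcs are kept as point sets, without parametrization, so that joining them becomes a
  union and orientation can be forgotten.\<close>

definition arc_between :: "complex \<Rightarrow> complex \<Rightarrow> complex set \<Rightarrow> bool" where
  "arc_between a b A \<longleftrightarrow> (\<exists>g. arc g \<and> pathstart g = a \<and> pathfinish g = b \<and> path_image g = A)"

lemma arc_between_sym: "arc_between a b A \<Longrightarrow> arc_between b a A"
  unfolding arc_between_def
  by (metis arc_reversepath path_image_reversepath pathfinish_reversepath pathstart_reversepath)

lemma arc_between_ends:
  assumes "arc_between a b A"
  shows "a \<in> A" "b \<in> A" "a \<noteq> b"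
  using assms unfolding arc_between_def
  by (metis pathstart_in_path_image, metis pathfinish_in_path_image, metis arc_distinct_ends)

lemma arc_between_compact: "arc_between a b A \<Longrightarrow> compact A"
  by (auto simp: arc_between_def compact_arc_image)

lemma arc_between_connected: "arc_between a b A \<Longrightarrow> connected A"
  by (auto simp: arc_between_def connected_arc_image)

lemma arc_between_endless:
  assumes "arc_between a b A"
  shows "connected (A - {a, b})" "A - {a, b} \<noteq> {}" "A \<subseteq> closure (A - {a, b})"
proof -
  obtain g where g: "arc g" "pathstart g = a" "pathfinish g = b" "path_image g = A"
    using assms by (auto simp: arc_between_def)
  show con: "connected (A - {a, b})"
    using connected_simple_path_endless[OF arc_imp_simple_path[OF g(1)]] g by simp
  show ne: "A - {a, b} \<noteq> {}"
    using nonempty_simple_path_endless[OF arc_imp_simple_path[OF g(1)]] g by simp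
  show "A \<subseteq> closure (A - {a, b})"
  proof
    fix x assume "x \<in> A"
    then have "x islimpt A"
      using connected_imp_perfect[OF arc_between_connected[OF assms]] arc_between_ends[OF assms]
      by blast
    then have "x islimpt (A - {a, b})"
      by (metis finite.emptyI finite.insertI islimpt_Un_finite Un_Diff_cancel2 sup.commute)
    then show "x \<in> closure (A - {a, b})"
      by (simp add: closure_def)
  qed
qed

lemma arc_between_join:
  assumes "arc_between a b A" "arc_between b c B" "A \<inter> B = {b}"
  shows "arc_between a c (A \<union> B)"
proof -
  obtain g h where g: "arc g" "pathstart g = a" "pathfinish g = b" "path_image g = A"
    and h: "arc h" "pathstart h = b" "pathfinish h = c" "path_image h = B"
    using assms(1,2) by (auto simp: arc_between_def)
  have "arc (g +++ h)"
    using g h assms(3) by (intro arc_join) auto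
  then show ?thesis
    unfolding arc_between_def using g h by (intro exI[of _ "g +++ h"]) (auto simp: path_image_join)
qed

lemma jordan_two_arcs:
  assumes "arc_between a b A" "arc_between a b B" "A \<inter> B = {a, b}"
  shows "inside (A \<union> B) \<noteq> {}" "open (inside (A \<union> B))" "connected (inside (A \<union> B))"
    "frontier (inside (A \<union> B)) = A \<union> B"
    "connected (outside (A \<union> B))"
proof -
  obtain g h where g: "arc g" "pathstart g = a" "pathfinish g = b" "path_image g = A"
    and h: "arc h" "pathstart h = a" "pathfinish h = b" "path_image h = B"
    using assms(1,2) by (auto simp: arc_between_def)
  have "simple_path (g +++ reversepath h)" "pathfinish (g +++ reversepath h) = pathstart (g +++ reversepath h)"
    using g h assms(3) by (auto intro!: simple_path_join_loop arc_reversepath)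
  moreover have "path_image (g +++ reversepath h) = A \<union> B"
    using g h by (simp add: path_image_join)
  ultimately show "inside (A \<union> B) \<noteq> {}" "open (inside (A \<union> B))" "connected (inside (A \<union> B))"
    "frontier (inside (A \<union> B)) = A \<union> B"
    "connected (outside (A \<union> B))"
    using Jordan_inside_outside[of "g +++ reversepath h"] by metis+
qed

lemma connected_subset_inside:
  assumes "connected S" "S \<inter> J = {}" "frontier (inside J) = J" "S \<inter> inside J \<noteq> {}"
  shows "S \<subseteq> inside J"
  using connected_Int_frontier[OF assms(1,4)] assms by blast

lemma inside_disjoint: "z \<in> inside S \<Longrightarrow> z \<notin> S"
  using inside_no_overlap[of S] by blast

section \<open>Theta curves and drawings of the complete graph\<close>

lemma theta_split:
  assumes "arc_between a b A" "arc_between a b B" "arc_between a b C"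
    and "A \<inter> B = {a, b}" "A \<inter> C = {a, b}" "B \<inter> C = {a, b}"
    and "C \<inter> inside (A \<union> B) - {a, b} \<noteq> {}"
  shows "inside (A \<union> B) = inside (A \<union> C) \<union> inside (B \<union> C) \<union> (C - {a, b})"
proof -
  obtain f g h where f: "arc f" "pathstart f = a" "pathfinish f = b" "path_image f = A"
    and g: "arc g" "pathstart g = a" "pathfinish g = b" "path_image g = B"
    and h: "arc h" "pathstart h = a" "pathfinish h = b" "path_image h = C"
    using assms(1-3) by (auto simp: arc_between_def)
  show ?thesis
    by (rule split_inside_simple_closed_curve[of f a b g h])
      (use assms f g h arc_between_ends(3)[OF assms(1)] arc_imp_simple_path in auto)
qed

text \<open>The winding numbers of the three oriented cycles of a theta curve sum to zero.\<close>

lemma theta_inside: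
  assumes "arc_between a b A" "arc_between a b B" "arc_between a b C"
    and "A \<inter> B = {a, b}" "A \<inter> C = {a, b}" "B \<inter> C = {a, b}"
    and z: "z \<in> inside (A \<union> B)" "z \<notin> C"
  shows "z \<in> inside (A \<union> C) \<or> z \<in> inside (B \<union> C)"
proof (rule ccontr)
  assume neg: "\<not> ?thesis"
  obtain f g h where f: "arc f" "pathstart f = a" "pathfinish f = b" "path_image f = A"
    and g: "arc g" "pathstart g = a" "pathfinish g = b" "path_image g = B"
    and h: "arc h" "pathstart h = a" "pathfinish h = b" "path_image h = C"
    using assms(1-3) by (auto simp: arc_between_def)
  have zAB: "z \<notin> A" "z \<notin> B"
    using inside_disjoint[OF z(1)] by auto
  have wn: "winding_number (p +++ reversepath q) z = winding_number p z - winding_number q z"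
    if "arc p" "arc q" "z \<notin> path_image p" "z \<notin> path_image q" "pathfinish p = pathfinish q" for p q
    using that by (simp add: winding_number_join winding_number_reversepath arc_imp_path)
  have zero: "winding_number p z - winding_number q z = 0"
    if "arc p" "arc q" "z \<notin> path_image p" "z \<notin> path_image q" "pathfinish p = pathfinish q"
      "pathstart p = pathstart q" "z \<notin> inside (path_image p \<union> path_image q)" for p q
  proof -
    have "z \<in> outside (path_image p \<union> path_image q)"
      using that inside_Un_outside[of "path_image p \<union> path_image q"] by blast
    then have "z \<in> outside (path_image (p +++ reversepath q))"
      using that by (simp add: path_image_join)
    then have "winding_number (p +++ reversepath q) z = 0"
      using that by (intro winding_number_zero_in_outside) (auto simp: arc_imp_path)
    then show ?thesis using wn that by simp
  qed
  have "winding_number f z - winding_number h z = 0" "winding_number g z - winding_number h z = 0"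
    using zero[of f h] zero[of g h] f g h zAB z(2) neg by simp_all
  then have "winding_number (f +++ reversepath g) z = 0"
    using wn[of f g] f g zAB by simp
  moreover have "simple_path (f +++ reversepath g)"
    using f g assms(4) by (auto intro!: simple_path_join_loop arc_reversepath)
  from simple_closed_path_abs_winding_number_inside[OF this, of z]
  have "\<bar>Re (winding_number (f +++ reversepath g) z)\<bar> = 1"
    using z(1) f g by (simp add: path_image_join)
  ultimately show False by simp
qed

definition K4_drawing where
  "K4_drawing a b c d AB AC AD BC BD CD \<longleftrightarrow>
     arc_between a b AB \<and> arc_between a c AC \<and> arc_between a d AD \<and>
     arc_between b c BC \<and> arc_between b d BD \<and> arc_between c d CD \<and>
     AB \<inter> AC = {a} \<and> AB \<inter> AD = {a} \<and> AC \<inter> AD = {a} \<and>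
     AB \<inter> BC = {b} \<and> AB \<inter> BD = {b} \<and> BC \<inter> BD = {b} \<and>
     AC \<inter> BC = {c} \<and> AC \<inter> CD = {c} \<and> BC \<inter> CD = {c} \<and>
     AD \<inter> BD = {d} \<and> AD \<inter> CD = {d} \<and> BD \<inter> CD = {d} \<and>
     AB \<inter> CD = {} \<and> AC \<inter> BD = {} \<and> AD \<inter> BC = {}"

text \<open>The three adjacent transpositions generate all permutations of the branch points; every
  symmetry argument below is a chain of them.\<close>

lemma K4_drawing_swap12:
  "K4_drawing a b c d AB AC AD BC BD CD \<Longrightarrow> K4_drawing b a c d AB BC BD AC AD CD"
  unfolding K4_drawing_def by (auto simp: arc_between_sym Int_commute)

lemma K4_drawing_swap23:
  "K4_drawing a b c d AB AC AD BC BD CD \<Longrightarrow> K4_drawing a c b d AC AB AD BC CD BD"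
  unfolding K4_drawing_def by (auto simp: arc_between_sym Int_commute)

lemma K4_drawing_swap34:
  "K4_drawing a b c d AB AC AD BC BD CD \<Longrightarrow> K4_drawing a b d c AB AD AC BD BC CD"
  unfolding K4_drawing_def by (auto simp: arc_between_sym Int_commute)

text \<open>The edge from \<open>a\<close> to \<open>b\<close> and the detours through
  \<open>c\<close> and \<open>d\<close> form a theta curve.\<close>

lemma K4_theta:
  assumes "K4_drawing a b c d AB AC AD BC BD CD"
  shows "arc_between a b AB" "arc_between a b (AC \<union> BC)" "arc_between a b (AD \<union> BD)"
    "AB \<inter> (AC \<union> BC) = {a, b}" "AB \<inter> (AD \<union> BD) = {a, b}" "(AC \<union> BC) \<inter> (AD \<union> BD) = {a, b}"
proof -
  note K = assms[unfolded K4_drawing_def]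
  show "arc_between a b AB" using K by simp
  show "arc_between a b (AC \<union> BC)"
    using K by (intro arc_between_join[of a c AC b BC]) (auto simp: arc_between_sym)
  show "arc_between a b (AD \<union> BD)"
    using K by (intro arc_between_join[of a d AD b BD]) (auto simp: arc_between_sym)
  have "BC \<inter> AD = {}" using K by (simp add: Int_commute)
  with K show "AB \<inter> (AC \<union> BC) = {a, b}" "AB \<inter> (AD \<union> BD) = {a, b}" "(AC \<union> BC) \<inter> (AD \<union> BD) = {a, b}"
    by (simp_all add: Int_Un_distrib Int_Un_distrib2 insert_commute)
qed

lemma K4_notin:
  assumes "K4_drawing a b c d AB AC AD BC BD CD"
  shows "d \<notin> AB" "d \<notin> AC" "d \<notin> BC" "c \<notin> AB" "c \<notin> AD" "c \<notin> BD"
    "c \<in> AC" "c \<in> BC" "d \<in> AD" "d \<in> BD" "c \<in> CD" "d \<in> CD" "c \<noteq> d" "a \<noteq> c" "a \<noteq> d" "b \<noteq> c" "b \<noteq> d"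
proof -
  note K = assms[unfolded K4_drawing_def]
  have *: "X \<inter> Y = {p} \<Longrightarrow> q \<in> Y \<Longrightarrow> p \<noteq> q \<Longrightarrow> q \<notin> X" for X Y p and q :: complex by auto
  note e = arc_between_ends
  show ends: "c \<in> AC" "c \<in> BC" "d \<in> AD" "d \<in> BD" "c \<in> CD" "d \<in> CD"
    "c \<noteq> d" "a \<noteq> c" "a \<noteq> d" "b \<noteq> c" "b \<noteq> d"
    using K e[of a c AC] e[of b c BC] e[of a d AD] e[of b d BD] e[of c d CD] by simp_all
  show "d \<notin> AB" using K ends by (intro *[of AB AD a]) simp_all
  show "d \<notin> AC" using K ends by (intro *[of AC AD a]) simp_all
  show "d \<notin> BC" using K ends by (intro *[of BC BD b]) simp_all
  show "c \<notin> AB" using K ends by (intro *[of AB AC a]) simp_all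
  show "c \<notin> AD" using K ends by (intro *[of AD AC a]) (simp_all add: Int_commute)
  show "c \<notin> BD" using K ends by (intro *[of BD BC b]) (simp_all add: Int_commute)
qed

text \<open>The closure of the inside adds only the triangle itself, and \<open>d\<close> is not on
  the triangle.\<close>

lemma K4_opposite_inside:
  assumes K: "K4_drawing a b c d AB AC AD BC BD CD"
    and "S \<subseteq> inside (AB \<union> (AC \<union> BC))" "d \<in> closure S"
  shows "d \<in> inside (AB \<union> (AC \<union> BC))"
proof -
  have "d \<in> closure (inside (AB \<union> (AC \<union> BC)))"
    using assms(2,3) closure_mono by blast
  then show ?thesis
    using jordan_two_arcs(4)[OF K4_theta(1,2,4)[OF K]] K4_notin[OF K] 
    by (auto simp: closure_Un_frontier)
qed

text \<open>The inside is open, so if it contained \<open>d\<close> it would meet \<open>U\<close>;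
  being connected and off the triangle, \<open>U\<close> would then lie inside entirely.\<close>

lemma K4_opposite_outside:
  assumes K: "K4_drawing a b c d AB AC AD BC BD CD"
    and "connected U" "U \<inter> (AB \<union> AC \<union> BC) = {}" "d \<in> closure U" "\<not> U \<subseteq> inside (AB \<union> (AC \<union> BC))"
  shows "d \<notin> inside (AB \<union> (AC \<union> BC))"
proof
  assume "d \<in> inside (AB \<union> (AC \<union> BC))"
  then have "inside (AB \<union> (AC \<union> BC)) \<inter> U \<noteq> {}"
    using assms(4) jordan_two_arcs(2)[OF K4_theta(1,2,4)[OF K]]
    by (meson closure_iff_nhds_not_empty open_Int_closure_eq_empty disjoint_iff)
  then have "U \<subseteq> inside (AB \<union> (AC \<union> BC))"
    using assms(2,3) jordan_two_arcs(4)[OF K4_theta(1,2,4)[OF K]] by (intro connected_subset_inside) auto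
  then show False using assms by blast
qed

text \<open>By two theta curves, a point inside the triangle \<open>abc\<close> and off the drawing
  is inside one of the three triangles at \<open>d\<close>. So \<open>U\<close> would lie inside two
  triangles with a common side, which \<open>not_both\<close> excludes.\<close>

lemma K4_not_inside_triangle:
  assumes K: "K4_drawing a b c d AB AC AD BC BD CD"
    and U: "connected U" "U \<noteq> {}" "U \<inter> (AB \<union> AC \<union> AD \<union> BC \<union> BD \<union> CD) = {}"
    and cl: "{a, b, c, d} \<subseteq> closure U"
  shows "\<not> U \<subseteq> inside (AB \<union> (AC \<union> BC))"
proof
  assume sub: "U \<subseteq> inside (AB \<union> (AC \<union> BC))"
  \<comment> \<open>With \<open>d\<close> inside the first triangle, the inside of the second is
    part of the inside of the first; but \<open>c\<close>, which is inside the second, lies on the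
    first.\<close>
  have not_both: "\<not> (U \<subseteq> inside (AB \<union> (AC \<union> BC)) \<and> U \<subseteq> inside (AB \<union> (AD \<union> BD)))"
    if K: "K4_drawing a b c d AB AC AD BC BD CD" and cl: "{a, b, c, d} \<subseteq> closure U"
    for a b c d AB AC AD BC BD CD
  proof (safe)
    assume s: "U \<subseteq> inside (AB \<union> (AC \<union> BC))" "U \<subseteq> inside (AB \<union> (AD \<union> BD))"
    have "d \<in> inside (AB \<union> (AC \<union> BC))"
      using K4_opposite_inside[OF K s(1)] cl by auto
    then have "(AD \<union> BD) \<inter> inside (AB \<union> (AC \<union> BC)) - {a, b} \<noteq> {}"
      using K4_notin[OF K] by auto
    from theta_split[OF K4_theta(1,2,3,4,5,6)[OF K] this]
    have "inside (AB \<union> (AD \<union> BD)) \<subseteq> inside (AB \<union> (AC \<union> BC))" by auto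
    moreover have "c \<in> inside (AB \<union> (AD \<union> BD))"
      using K4_opposite_inside[OF K4_drawing_swap34[OF K] s(2)] cl by auto
    ultimately show False
      using K4_notin[OF K] inside_disjoint[of c "AB \<union> (AC \<union> BC)"] by auto
  qed
  have sub': "U \<subseteq> inside (AC \<union> (AB \<union> BC))" "U \<subseteq> inside (BC \<union> (AB \<union> AC))"
    using sub by (simp_all add: ac_simps)
  have 1: "\<not> U \<subseteq> inside (AB \<union> (AD \<union> BD))"
    using not_both[OF K cl] sub by auto
  have 2: "\<not> U \<subseteq> inside (AC \<union> (AD \<union> CD))"
    using not_both[OF K4_drawing_swap23[OF K]] cl sub' by auto
  have 3: "\<not> U \<subseteq> inside (BC \<union> (BD \<union> CD))"
    using not_both[OF K4_drawing_swap23[OF K4_drawing_swap12[OF K]]] cl sub' by (auto simp: Un_commute)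
  obtain u where u: "u \<in> U" using U by auto
  have disj: "u \<notin> inside J" if "\<not> U \<subseteq> inside J" "frontier (inside J) = J"
    "J \<subseteq> AB \<union> AC \<union> AD \<union> BC \<union> BD \<union> CD" for J
    using connected_subset_inside[OF U(1), of J] that U(3) u by blast
  have u1: "u \<notin> inside (AB \<union> (AD \<union> BD))"
    using jordan_two_arcs(4)[OF K4_theta(1,3,5)[OF K]] by (intro disj 1) auto
  note K2 = K4_drawing_swap23[OF K]
  have u2: "u \<notin> inside (AC \<union> (AD \<union> CD))"
    using jordan_two_arcs(4)[OF K4_theta(1,3,5)[OF K2]] by (intro disj 2) auto
  note K3 = K4_drawing_swap23[OF K4_drawing_swap12[OF K]]
  have u3: "u \<notin> inside (BC \<union> (BD \<union> CD))"
    using jordan_two_arcs(4)[OF K4_theta(1,3,5)[OF K3]] by (intro disj 3) auto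
  have "u \<in> inside (AB \<union> (AC \<union> BC))" "u \<notin> AD \<union> BD" using sub u U(3) by auto
  from theta_inside[OF K4_theta(1,2,3,4,5,6)[OF K] this] u1
  have "u \<in> inside ((AC \<union> BC) \<union> (AD \<union> BD))" by auto
  then have u4: "u \<in> inside ((AC \<union> AD) \<union> (BC \<union> BD))" by (simp add: ac_simps)
  \<comment> \<open>\<open>K5\<close> interchanges the pair \<open>a\<close>, \<open>b\<close> with
    the pair \<open>c\<close>, \<open>d\<close>, which gives the theta curve between
    \<open>c\<close> and \<open>d\<close>.\<close>
  note K5 = K4_drawing_swap23[OF K4_drawing_swap34[OF K4_drawing_swap12[OF K4_drawing_swap23[OF K]]]]
  have th: "arc_between c d CD" "arc_between c d (AC \<union> AD)" "arc_between c d (BC \<union> BD)"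
    "CD \<inter> (AC \<union> AD) = {c, d}" "CD \<inter> (BC \<union> BD) = {c, d}" "(AC \<union> AD) \<inter> (BC \<union> BD) = {c, d}"
    using K4_theta[OF K5] by simp_all
  have "u \<in> inside ((AC \<union> AD) \<union> CD) \<or> u \<in> inside ((BC \<union> BD) \<union> CD)"
    using u U(3) by (intro theta_inside[OF th(2,3,1) th(6)] u4) (use th in auto)
  then show False using u2 u3 by (simp add: ac_simps)
qed

text \<open>The inside of the triangle \<open>abc\<close> avoids the detour through
  \<open>d\<close>. By the theta curve it lies inside the triangle \<open>abd\<close>, which would
  put \<open>c\<close> there, or inside the four-cycle \<open>acbd\<close>, and then its boundary
  arc \<open>AB\<close> runs there too.\<close>

lemma K4_edge_inside:
  assumes K: "K4_drawing a b c d AB AC AD BC BD CD"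
    and c: "c \<notin> inside (AB \<union> (AD \<union> BD))" and d: "d \<notin> inside (AB \<union> (AC \<union> BC))"
  shows "AB - {a, b} \<subseteq> inside ((AC \<union> BC) \<union> (AD \<union> BD))"
proof -
  note th = K4_theta[OF K]
  define I where "I = inside (AB \<union> (AC \<union> BC))"
  have I: "I \<noteq> {}" "connected I" "frontier I = AB \<union> (AC \<union> BC)" "I \<inter> (AB \<union> (AC \<union> BC)) = {}"
    using jordan_two_arcs[OF th(1,2,4)] inside_no_overlap[of "AB \<union> (AC \<union> BC)"] by (auto simp: I_def)
  have endless: "(AD \<union> BD - {a, b}) \<inter> I = {}"
  proof (rule ccontr)
    assume "(AD \<union> BD - {a, b}) \<inter> I \<noteq> {}"
    then have "AD \<union> BD - {a, b} \<subseteq> I"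
      unfolding I_def using th I(3)
      by (intro connected_subset_inside arc_between_endless(1)) (auto simp: I_def)
    then show False using d K4_notin[OF K] by (auto simp: I_def)
  qed
  then have I': "I \<inter> (AD \<union> BD) = {}"
    using I(4) arc_between_ends[OF th(1)] by auto
  obtain p where p: "p \<in> I" using I by auto
  have "p \<in> inside (AB \<union> (AD \<union> BD)) \<or> p \<in> inside ((AC \<union> BC) \<union> (AD \<union> BD))"
    using p I' by (intro theta_inside[OF th(1,2,3) th(4,5,6)]) (auto simp: I_def)
  then show ?thesis
  proof
    assume "p \<in> inside (AB \<union> (AD \<union> BD))"
    then have "I \<subseteq> inside (AB \<union> (AD \<union> BD))"
      using I I' p jordan_two_arcs(4)[OF th(1,3,5)] by (intro connected_subset_inside) auto
    moreover have "c \<in> closure I"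
      using I(3) K4_notin[OF K] by (auto simp: closure_Un_frontier)
    ultimately have "c \<in> inside (AB \<union> (AD \<union> BD))"
      using K4_opposite_inside[OF K4_drawing_swap34[OF K]] by auto
    then show ?thesis using c by simp
  next
    assume "p \<in> inside ((AC \<union> BC) \<union> (AD \<union> BD))"
    then have "I \<subseteq> inside ((AC \<union> BC) \<union> (AD \<union> BD))"
      using I I' p jordan_two_arcs(4)[OF th(2,3,6)] by (intro connected_subset_inside) auto
    then have "AB \<subseteq> closure (inside ((AC \<union> BC) \<union> (AD \<union> BD)))"
      using I(3) closure_mono[of I] by (auto simp: closure_Un_frontier)
    then show ?thesis
      using th(4,5) jordan_two_arcs(4)[OF th(2,3,6)] by (auto simp: closure_Un_frontier)
  qed
qed

text \<open>No branch point is inside the triangle of the other three, so both diagonals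
  \<open>AB\<close> and \<open>CD\<close> of the four-cycle \<open>acbd\<close> run inside it.
  \<open>AB\<close> cuts this inside into two triangles; \<open>CD\<close> cannot cross
  \<open>AB\<close>, so it stays in one of them and drags \<open>d\<close> or \<open>c\<close> into
  its inside.\<close>

theorem K4_not_outerplanar:
  assumes K: "K4_drawing a b c d AB AC AD BC BD CD"
    and U: "connected U" "U \<inter> (AB \<union> AC \<union> AD \<union> BC \<union> BD \<union> CD) = {}"
    and cl: "{a, b, c, d} \<subseteq> closure U"
  shows False
proof -
  have ne: "U \<noteq> {}" using cl by auto
  have out: "d \<notin> inside (AB \<union> (AC \<union> BC))"
    if K: "K4_drawing a b c d AB AC AD BC BD CD" and "{a, b, c, d} \<subseteq> closure U"
      "U \<inter> (AB \<union> AC \<union> AD \<union> BC \<union> BD \<union> CD) = {}"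
    for a b c d AB AC AD BC BD CD
    using that U(1) ne by (intro K4_opposite_outside[OF K U(1)] K4_not_inside_triangle[OF K]) auto
  note K5 = K4_drawing_swap23[OF K4_drawing_swap34[OF K4_drawing_swap12[OF K4_drawing_swap23[OF K]]]]
  have d: "d \<notin> inside (AB \<union> (AC \<union> BC))"
    using out[OF K] cl U by auto
  have c: "c \<notin> inside (AB \<union> (AD \<union> BD))"
    using out[OF K4_drawing_swap34[OF K]] cl U by auto
  have b: "b \<notin> inside (CD \<union> (AC \<union> AD))"
    using out[OF K5] cl U by auto
  have a: "a \<notin> inside (CD \<union> (BC \<union> BD))"
    using out[OF K4_drawing_swap34[OF K5]] cl U by auto
  have AB: "AB - {a, b} \<subseteq> inside ((AC \<union> BC) \<union> (AD \<union> BD))"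
    by (rule K4_edge_inside[OF K c d])
  have "CD - {c, d} \<subseteq> inside ((AC \<union> AD) \<union> (BC \<union> BD))"
    by (rule K4_edge_inside[OF K5 a b])
  then have CD: "CD - {c, d} \<subseteq> inside ((AC \<union> BC) \<union> (AD \<union> BD))"
    by (simp add: ac_simps)
  note th = K4_theta[OF K]
  have "AB \<inter> inside ((AC \<union> BC) \<union> (AD \<union> BD)) - {a, b} \<noteq> {}"
    using AB arc_between_endless(2)[OF th(1)] by auto
  with th have split: "inside ((AC \<union> BC) \<union> (AD \<union> BD)) =
      inside ((AC \<union> BC) \<union> AB) \<union> inside ((AD \<union> BD) \<union> AB) \<union> (AB - {a, b})"
    by (intro theta_split) auto
  have arcCD: "arc_between c d CD" and dis: "AB \<inter> CD = {}" "AC \<inter> CD = {c}" "BC \<inter> CD = {c}"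
    "AD \<inter> CD = {d}" "BD \<inter> CD = {d}"
    using K by (auto simp: K4_drawing_def)
  note e = arc_between_endless[OF arcCD]
  consider "(CD - {c, d}) \<inter> inside (AB \<union> (AC \<union> BC)) \<noteq> {}"
    | "(CD - {c, d}) \<inter> inside (AB \<union> (AD \<union> BD)) \<noteq> {}"
    using CD e(2) dis(1) unfolding split by (auto simp: Un_commute)
  then show False
  proof cases
    case 1
    then have "CD - {c, d} \<subseteq> inside (AB \<union> (AC \<union> BC))"
      using e(1) dis jordan_two_arcs(4)[OF th(1,2,4)] by (intro connected_subset_inside) auto
    then have "d \<in> inside (AB \<union> (AC \<union> BC))"
      using e(3) arc_between_ends[OF arcCD] by (intro K4_opposite_inside[OF K]) auto
    then show False using d by simp
  next
    case 2
    then have "CD - {c, d} \<subseteq> inside (AB \<union> (AD \<union> BD))"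
      using e(1) dis jordan_two_arcs(4)[OF th(1,3,5)] by (intro connected_subset_inside) auto
    then have "c \<in> inside (AB \<union> (AD \<union> BD))"
      using e(3) arc_between_ends[OF arcCD] by (intro K4_opposite_inside[OF K4_drawing_swap34[OF K]]) auto
    then show False using c by simp
  qed
qed

subsection \<open>Faces of a planar embedding\<close>

text \<open>The inverse parametrization would embed a nonempty open subset of the plane into the
  line, against invariance of dimension.\<close>

lemma interior_arc_between:
  assumes "arc_between a b A"
  shows "interior A = {}"
proof (rule ccontr)
  assume ne: "interior A \<noteq> {}"
  obtain g where "arc g" "path_image g = A"
    using assms by (auto simp: arc_between_def)
  then obtain h where h: "homeomorphism {0..1} A g h"
    using homeomorphism_arc by metis
  have "inj_on h (interior A)"
    using h interior_subset[of A] by (intro inj_onI) (metis homeomorphism_def subsetD)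
  moreover have "continuous_on (interior A) h"
    using h interior_subset continuous_on_subset by (metis homeomorphism_def)
  ultimately have "DIM(complex) \<le> DIM(real)"
    using ne by (intro invariance_of_dimension) auto
  then show False by simp
qed

lemma connected_arc_between_complement:
  "arc_between a b A \<Longrightarrow> connected (- A)"
  by (auto simp: arc_between_def connected_arc_complement)

text \<open>A member that meets \<open>K\<close> lies in \<open>K\<close>, so both sets are finite
  unions of members. Closedness is what Janiszewski's theorem asks of the two parts.\<close>

lemma path_component_finite_Union:
  fixes \<A> :: "'a::topological_space set set" and a :: 'a
  assumes "finite \<A>" "\<And>S. S \<in> \<A> \<Longrightarrow> closed S \<and> path_connected S"
  defines "K \<equiv> path_component_set (\<Union>\<A>) a"
  shows "closed K" "closed (\<Union>\<A> - K)"
proof -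
  have sub: "S \<subseteq> K" if S: "S \<in> \<A>" "S \<inter> K \<noteq> {}" for S
  proof
    fix x assume "x \<in> S"
    obtain y where y: "y \<in> S" "path_component (\<Union>\<A>) a y"
      using S by (auto simp: K_def)
    have "path_component S y x"
      using assms(2)[OF S(1)] y \<open>x \<in> S\<close> by (auto simp: path_connected_component)
    then have "path_component (\<Union>\<A>) y x"
      by (rule path_component_of_subset[rotated]) (use S in auto)
    then show "x \<in> K"
      using y(2) unfolding K_def by (metis mem_Collect_eq path_component_trans)
  qed
  have KA: "K \<subseteq> \<Union>\<A>"
    unfolding K_def by (rule path_component_subset)
  have "K = \<Union>{S \<in> \<A>. S \<inter> K \<noteq> {}}"
    using sub KA by blast
  moreover have "closed (\<Union>{S \<in> \<A>. S \<inter> K \<noteq> {}})"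
    using assms by (intro closed_Union) auto
  ultimately show "closed K" by simp
  have "\<Union>\<A> - K = \<Union>{S \<in> \<A>. S \<inter> K = {}}"
    using sub by blast
  moreover have "closed (\<Union>{S \<in> \<A>. S \<inter> K = {}})"
    using assms by (intro closed_Union) auto
  ultimately show "closed (\<Union>\<A> - K)" by simp
qed

text \<open>Adding the arc \<open>A\<close> to \<open>\<Union>\<A>\<close> cuts the complement of \<open>\<Union>\<A>\<close> at most along \<open>I\<close>: if the end points
  of \<open>A\<close> are joined within \<open>\<Union>\<A>\<close>, then \<open>I\<close> is the inside of the Jordan curve closed up by \<open>A\<close>, and
  otherwise nothing is separated. Both cases are instances of Janiszewski's theorem.\<close>

lemma arc_addition:
  fixes \<A> :: "complex set set"
  assumes \<A>: "finite \<A>" "\<And>S. S \<in> \<A> \<Longrightarrow> compact S \<and> path_connected S"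
    and A: "arc_between a b A" and AD: "A \<inter> \<Union>\<A> = {a, b}"
  obtains I where "A \<subseteq> closure (I - A)"
    "\<forall>x y. x \<notin> A \<longrightarrow> y \<notin> A \<longrightarrow> connected_component (- \<Union>\<A>) x y \<longrightarrow> (x \<in> I \<longleftrightarrow> y \<in> I) \<longrightarrow>
      connected_component (- (\<Union>\<A> \<union> A)) x y"
proof -
  define D where "D = \<Union>\<A>"
  define K where "K = path_component_set D a"
  have "closed S \<and> path_connected S" if "S \<in> \<A>" for S
    using \<A>(2)[OF that] compact_imp_closed by blast
  note cl = path_component_finite_Union[OF \<A>(1) this, of a, folded D_def, folded K_def]
  have KD: "K \<subseteq> D"
    unfolding K_def by (rule path_component_subset)
  have cD: "closed D"
    unfolding D_def using \<A> by (intro closed_Union) (auto simp: compact_imp_closed)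
  have aD: "a \<in> D" "b \<in> D" using AD by (auto simp: D_def)
  then have aK: "a \<in> K" by (simp add: K_def path_component_refl)
  have cA: "compact A" "connected A" and ab: "a \<noteq> b"
    using A arc_between_compact arc_between_connected arc_between_ends by blast+
  show thesis
  proof (cases "b \<in> K")
    case True
    then obtain g where g: "path g" "path_image g \<subseteq> D" "pathstart g = a" "pathfinish g = b"
      by (auto simp: K_def path_component_def)
    then obtain h where h: "arc h" "path_image h \<subseteq> D" "pathstart h = a" "pathfinish h = b"
      using path_contains_arc[of g a b] ab by (metis order_trans)
    define B where "B = path_image h"
    have B: "arc_between a b B" "B \<subseteq> D"
      using h by (auto simp: arc_between_def B_def)
    have ABab: "A \<inter> B = {a, b}"
      using AD B arc_between_ends[OF B(1)] arc_between_ends[OF A] by (auto simp: D_def)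
    note J = jordan_two_arcs[OF A B(1) ABab]
    show thesis
    proof (rule that[of "inside (A \<union> B)"]; (intro allI impI)?)
      have "inside (A \<union> B) - A = inside (A \<union> B)"
        using inside_disjoint by blast
      then show "A \<subseteq> closure (inside (A \<union> B) - A)"
        using J(4) by (auto simp: closure_Un_frontier)
    next
      fix x y
      assume xy: "x \<notin> A" "y \<notin> A" "connected_component (- \<Union>\<A>) x y"
        "x \<in> inside (A \<union> B) \<longleftrightarrow> y \<in> inside (A \<union> B)"
      have xyD: "x \<notin> D" "y \<notin> D"
        using connected_component_in[OF xy(3)] by (auto simp: D_def)
      have cc: "connected_component (- (A \<union> B)) x y"
      proof (cases "x \<in> inside (A \<union> B)")
        case True
        then show ?thesis
          using J(3) xy(4) inside_no_overlap[of "A \<union> B"] unfolding connected_component_def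
          by (intro exI[of _ "inside (A \<union> B)"]) blast
      next
        case False
        then have "x \<in> outside (A \<union> B)" "y \<in> outside (A \<union> B)"
          using xy xyD B(2) inside_Un_outside[of "A \<union> B"] by blast+
        then show ?thesis
          using J(5) outside_no_overlap[of "A \<union> B"] unfolding connected_component_def
          by (intro exI[of _ "outside (A \<union> B)"]) blast
      qed
      \<comment> \<open>Janiszewski's theorem for the Jordan curve and \<open>D\<close>, whose
        intersection is the connected arc \<open>B\<close>.\<close>
      have "connected_component (- ((A \<union> B) \<union> D)) x y"
      proof (rule Janiszewski)
        have "(A \<union> B) \<inter> D = B"
          using AD B arc_between_ends[OF B(1)] by (auto simp: D_def)
        then show "connected ((A \<union> B) \<inter> D)"
          using arc_between_connected[OF B(1)] by simp
      qed (use cc xy cD cA arc_between_compact[OF B(1)] in \<open>auto simp: D_def compact_Un\<close>)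
      moreover have "(A \<union> B) \<union> D = \<Union>\<A> \<union> A"
        using B by (auto simp: D_def)
      ultimately show "connected_component (- (\<Union>\<A> \<union> A)) x y" by simp
    qed
  next
    case False
    \<comment> \<open>Janiszewski's theorem is applied twice, first to \<open>A\<close> and
      \<open>K\<close>, then to their union and the rest of \<open>D\<close>; each time the
      intersection is a single point.\<close>
    have int: "A \<inter> K = {a}" "(A \<union> K) \<inter> (D - K) = {b}"
      using AD False aK aD KD arc_between_ends[OF A] by (auto simp: D_def)
    show thesis
    proof (rule that[of UNIV]; (intro allI impI)?)
      show "A \<subseteq> closure (UNIV - A)"
        using interior_arc_between[OF A] by (simp add: closure_interior Compl_eq_Diff_UNIV[symmetric])
    next
      fix x y
      assume xy: "x \<notin> A" "y \<notin> A" "connected_component (- \<Union>\<A>) x y"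
      have mono: "connected_component (- S) x y" if "S \<subseteq> D" for S
        by (rule connected_component_of_subset[OF xy(3)]) (use that in \<open>auto simp: D_def\<close>)
      have "connected_component (- A) x y"
        using connected_arc_between_complement[OF A] xy by (auto simp: connected_iff_connected_component)
      then have "connected_component (- (A \<union> K)) x y"
        using cA cl(1) mono[OF KD] int(1) by (intro Janiszewski) auto
      moreover have "compact K"
        using KD cl(1) \<A> unfolding D_def
        by (metis compact_Int_closed compact_Union inf.absorb_iff2)
      ultimately have "connected_component (- ((A \<union> K) \<union> (D - K))) x y"
        using cA cl(2) mono[of "D - K"] int(2) by (intro Janiszewski[of "A \<union> K" "D - K"]) auto
      moreover have "(A \<union> K) \<union> (D - K) = \<Union>\<A> \<union> A"
        using KD by (auto simp: D_def)
      ultimately show "connected_component (- (\<Union>\<A> \<union> A)) x y" by simp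
    qed
  qed
qed

text \<open>A new component is determined by the old component around one of its points and by
  whether that point lies in \<open>I\<close>, so the number of components at most doubles.\<close>

lemma finite_components_arc_addition:
  fixes \<A> :: "complex set set"
  assumes \<A>: "finite \<A>" "\<And>S. S \<in> \<A> \<Longrightarrow> compact S \<and> path_connected S"
    and A: "arc_between a b A" and AD: "A \<inter> \<Union>\<A> = {a, b}"
    and fin: "finite (components (- \<Union>\<A>))"
  shows "finite (components (- (\<Union>\<A> \<union> A)))"
proof -
  obtain I where I: "\<forall>x y. x \<notin> A \<longrightarrow> y \<notin> A \<longrightarrow> connected_component (- \<Union>\<A>) x y \<longrightarrow> (x \<in> I \<longleftrightarrow> y \<in> I) \<longrightarrow>
      connected_component (- (\<Union>\<A> \<union> A)) x y"
    by (rule arc_addition[OF \<A> A AD]) blast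
  define p where "p C = (SOME x. x \<in> C)" for C :: "complex set"
  have p: "p C \<in> C" "p C \<notin> A" "p C \<notin> \<Union>\<A>" "connected_component_set (- (\<Union>\<A> \<union> A)) (p C) = C"
    if C: "C \<in> components (- (\<Union>\<A> \<union> A))" for C
  proof -
    show "p C \<in> C"
      unfolding p_def some_in_eq by (rule in_components_nonempty[OF C])
    then show "p C \<notin> A" "p C \<notin> \<Union>\<A>"
      using in_components_subset[OF C] by auto
    show "connected_component_set (- (\<Union>\<A> \<union> A)) (p C) = C"
      using C \<open>p C \<in> C\<close> unfolding components_iff using connected_component_eq by blast
  qed
  define F where "F C = (connected_component_set (- \<Union>\<A>) (p C), p C \<in> I)" for C
  have "inj_on F (components (- (\<Union>\<A> \<union> A)))"
  proof (rule inj_onI)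
    fix C C' assume C: "C \<in> components (- (\<Union>\<A> \<union> A))" "C' \<in> components (- (\<Union>\<A> \<union> A))" "F C = F C'"
    have eq: "connected_component_set (- \<Union>\<A>) (p C) = connected_component_set (- \<Union>\<A>) (p C')"
      "p C \<in> I \<longleftrightarrow> p C' \<in> I"
      using C(3) by (simp_all add: F_def)
    have "p C' \<in> connected_component_set (- \<Union>\<A>) (p C')"
      using p(3)[OF C(2)] by (simp add: connected_component_refl)
    then have "connected_component (- \<Union>\<A>) (p C) (p C')"
      unfolding eq(1)[symmetric] by simp
    then have "p C' \<in> connected_component_set (- (\<Union>\<A> \<union> A)) (p C)"
      using I p(2)[OF C(1)] p(2)[OF C(2)] eq(2) by blast
    then have "p C' \<in> C" unfolding p(4)[OF C(1)] .
    with p(1)[OF C(2)] show "C = C'"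
      using components_eq[OF C(1,2)] by blast
  qed
  moreover have "F ` components (- (\<Union>\<A> \<union> A)) \<subseteq> components (- \<Union>\<A>) \<times> UNIV"
    using p(3) unfolding F_def components_def by blast
  ultimately show ?thesis
    using fin by (intro finite_imageD[of F] finite_subset[of "F ` _" "components (- \<Union>\<A>) \<times> UNIV"]) auto
qed

text \<open>The arc without its ends lies in one old component. The points of that component that
  are in \<open>I\<close> and off the arc stay in one new component, and they accumulate at the
  whole arc.\<close>

lemma arc_in_closure_of_component:
  fixes \<A> :: "complex set set"
  assumes \<A>: "finite \<A>" "\<And>S. S \<in> \<A> \<Longrightarrow> compact S \<and> path_connected S"
    and A: "arc_between a b A" and AD: "A \<inter> \<Union>\<A> = {a, b}"
  obtains W where "W \<in> components (- (\<Union>\<A> \<union> A))" "A \<subseteq> closure W"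
proof -
  obtain I where AI: "A \<subseteq> closure (I - A)"
    and I: "\<forall>x y. x \<notin> A \<longrightarrow> y \<notin> A \<longrightarrow> connected_component (- \<Union>\<A>) x y \<longrightarrow> (x \<in> I \<longleftrightarrow> y \<in> I) \<longrightarrow>
      connected_component (- (\<Union>\<A> \<union> A)) x y"
    by (rule arc_addition[OF \<A> A AD]) blast
  note e = arc_between_endless[OF A]
  obtain q where q: "q \<in> A - {a, b}" using e(2) by auto
  define C where "C = connected_component_set (- \<Union>\<A>) q"
  have "closed (\<Union>\<A>)"
    using \<A> by (intro closed_Union) (auto simp: compact_imp_closed)
  then have "open C" unfolding C_def by (intro open_connected_component) auto
  have "A - {a, b} \<subseteq> C"
    unfolding C_def using e(1) q AD by (intro connected_component_maximal) auto
  have in_cl: "A - {a, b} \<subseteq> closure (C \<inter> (I - A))"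
    using open_Int_closure_subset[OF \<open>open C\<close>, of "I - A"] AI \<open>A - {a, b} \<subseteq> C\<close> by auto
  then have "C \<inter> (I - A) \<noteq> {}" using q by force
  then obtain x where x: "x \<in> C" "x \<in> I" "x \<notin> A" by auto
  define W where "W = connected_component_set (- (\<Union>\<A> \<union> A)) x"
  have "C \<inter> (I - A) \<subseteq> W"
  proof
    fix y assume "y \<in> C \<inter> (I - A)"
    moreover have "connected_component (- \<Union>\<A>) x y"
      using \<open>y \<in> _\<close> x(1) by (auto simp: C_def intro: connected_component_trans connected_component_sym)
    ultimately show "y \<in> W" using x I by (auto simp: W_def)
  qed
  then have "A - {a, b} \<subseteq> closure W" using in_cl closure_mono by blast
  then have "A \<subseteq> closure W" using e(3) by (metis closed_closure closure_minimal order_trans)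
  moreover have "W \<in> components (- (\<Union>\<A> \<union> A))"
    using x unfolding W_def C_def by (auto simp: components_def dest: connected_component_in)
  ultimately show thesis using that by blast
qed

section \<open>From families of sets to embedded graphs\<close>

definition pieces where
  "pieces V F \<phi> \<gamma> = (\<lambda>v. {\<phi> v}) ` V \<union> (\<lambda>e. path_image (\<gamma> e)) ` F"

lemma drawing_pieces: "drawing V F \<phi> \<gamma> = \<Union>(pieces V F \<phi> \<gamma>)"
  by (auto simp: drawing_def pieces_def)

lemma embedding_edge:
  assumes "planar_embedding V E \<phi> \<gamma>" "e \<in> E"
  obtains a b where "{a, b} = \<phi> ` e" "arc_between a b (path_image (\<gamma> e))"
  using assms unfolding planar_embedding_def arc_between_def by metis

lemma pieces_props:
  assumes "planar_embedding V E \<phi> \<gamma>" "F \<subseteq> E" "finite V" "finite F"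
  shows "finite (pieces V F \<phi> \<gamma>)"
    "\<And>S. S \<in> pieces V F \<phi> \<gamma> \<Longrightarrow> compact S \<and> path_connected S"
    "\<And>S. S \<in> pieces V F \<phi> \<gamma> \<Longrightarrow> interior S = {}"
proof -
  show "finite (pieces V F \<phi> \<gamma>)" using assms by (simp add: pieces_def)
  have "arc (\<gamma> e)" if "e \<in> F" for e
    using assms that by (auto simp: planar_embedding_def)
  then show "compact S \<and> path_connected S" if "S \<in> pieces V F \<phi> \<gamma>" for S
    using that by (auto simp: pieces_def compact_arc_image arc_imp_path path_connected_path_image)
  show "interior S = {}" if "S \<in> pieces V F \<phi> \<gamma>" for S
    using that embedding_edge[OF assms(1)] assms(2) interior_arc_between
    by (auto simp: pieces_def) (metis empty_iff subsetD)
qed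

lemma edge_Int_drawing:
  assumes "planar_embedding V E \<phi> \<gamma>" "F \<subseteq> E" "e \<in> E" "e \<notin> F"
  shows "path_image (\<gamma> e) \<inter> drawing V F \<phi> \<gamma> = \<phi> ` e"
proof -
  have "path_image (\<gamma> e) \<inter> \<phi> ` V = \<phi> ` e"
    "\<And>e'. e' \<in> F \<Longrightarrow> path_image (\<gamma> e) \<inter> path_image (\<gamma> e') = \<phi> ` (e \<inter> e')"
    using assms unfolding planar_embedding_def by (blast, metis subsetD)
  then show ?thesis unfolding drawing_def by blast
qed

lemma drawing_insert: "drawing V (insert e F) \<phi> \<gamma> = drawing V F \<phi> \<gamma> \<union> path_image (\<gamma> e)"
  by (auto simp: drawing_def)

text \<open>Edges are added one by one to the full vertex set; the base case is the plane without
  finitely many points, which is connected.\<close>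

lemma finite_components_drawing:
  assumes pe: "planar_embedding V E \<phi> \<gamma>" and V: "finite V"
  shows "finite F \<Longrightarrow> F \<subseteq> E \<Longrightarrow> finite (components (- drawing V F \<phi> \<gamma>))"
proof (induction F rule: finite_induct)
  case empty
  have "connected (UNIV - \<phi> ` V)"
    using V by (intro connected_open_delete_finite) auto
  then have "connected (- drawing V {} \<phi> \<gamma>)"
    by (simp add: drawing_def Compl_eq_Diff_UNIV)
  then show ?case
    by (metis connected_eq_connected_components_eq finite.simps infinite_imp_nonempty insertCI singletonD finite_subset subsetI)
next
  case (insert e F)
  obtain a b where ab: "{a, b} = \<phi> ` e" "arc_between a b (path_image (\<gamma> e))"
    using embedding_edge[OF pe, of e] insert.prems by auto
  have "path_image (\<gamma> e) \<inter> \<Union>(pieces V F \<phi> \<gamma>) = {a, b}"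
    using edge_Int_drawing[OF pe, of F e] insert ab by (simp add: drawing_pieces)
  then have "finite (components (- (\<Union>(pieces V F \<phi> \<gamma>) \<union> path_image (\<gamma> e))))"
    using insert pieces_props[OF pe _ V, of F]
    by (intro finite_components_arc_addition[OF _ _ ab(2)]) (auto simp: drawing_pieces)
  then show ?case by (simp only: drawing_insert drawing_pieces[of V F])
qed

lemma finite_edges: "finite V \<Longrightarrow> simple_graph V E \<Longrightarrow> finite E"
  by (rule finite_subset[of _ "Pow V"]) (auto simp: simple_graph_def)

lemma finite_faces:
  "finite V \<Longrightarrow> simple_graph V E \<Longrightarrow> planar_embedding V E \<phi> \<gamma> \<Longrightarrow> finite (faces V E \<phi> \<gamma>)"
  unfolding faces_def by (rule finite_components_drawing[OF _ _ finite_edges order_refl])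

lemma vertex_in_frontier:
  assumes "planar_embedding V E \<phi> \<gamma>" "finite V" "finite E" "f \<in> faces V E \<phi> \<gamma>" "i \<in> V" "\<phi> i \<in> closure f"
  shows "\<phi> i \<in> frontier f"
proof -
  have "\<phi> i \<in> drawing V E \<phi> \<gamma>" using assms(5) by (simp add: drawing_def)
  moreover have "f \<subseteq> - drawing V E \<phi> \<gamma>"
    using assms(4) unfolding faces_def by (rule in_components_subset)
  ultimately show ?thesis
    using assms(6) interior_subset[of f] unfolding frontier_def by blast
qed

text \<open>The edge is drawn last: the component whose closure contains the whole arc has both end
  points on its frontier.\<close>

lemma edge_common_face:
  assumes fin: "finite V" and sg: "simple_graph V E" and pe: "planar_embedding V E \<phi> \<gamma>" and e: "e \<in> E"
  obtains f where "f \<in> faces V E \<phi> \<gamma>" "\<forall>i\<in>e. \<phi> i \<in> frontier f"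
proof -
  have finE: "finite E" using fin sg by (rule finite_edges)
  obtain a b where ab: "{a, b} = \<phi> ` e" "arc_between a b (path_image (\<gamma> e))"
    using embedding_edge[OF pe e] by auto
  have "path_image (\<gamma> e) \<inter> \<Union>(pieces V (E - {e}) \<phi> \<gamma>) = {a, b}"
    using edge_Int_drawing[OF pe, of "E - {e}" e] e ab by (simp add: drawing_pieces)
  moreover note pp = pieces_props(1,2)[OF pe Diff_subset[of E "{e}"] fin finite_Diff[OF finE]]
  ultimately obtain W where W: "W \<in> components (- (\<Union>(pieces V (E - {e}) \<phi> \<gamma>) \<union> path_image (\<gamma> e)))"
    "path_image (\<gamma> e) \<subseteq> closure W"
    using arc_in_closure_of_component[OF pp ab(2)] by blast
  have "drawing V E \<phi> \<gamma> = \<Union>(pieces V (E - {e}) \<phi> \<gamma>) \<union> path_image (\<gamma> e)"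
    using drawing_insert[of V e "E - {e}" \<phi> \<gamma>] e by (simp add: insert_absorb drawing_pieces)
  then have face: "W \<in> faces V E \<phi> \<gamma>" using W by (simp add: faces_def)
  show thesis
  proof (rule that[OF face], rule ballI)
    fix i assume "i \<in> e"
    then have "\<phi> i \<in> {a, b}" "i \<in> V" using ab sg e by (auto simp: simple_graph_def)
    then show "\<phi> i \<in> frontier W"
      using W(2) arc_between_ends[OF ab(2)] by (intro vertex_in_frontier[OF pe fin finE face]) auto
  qed
qed

lemma interior_finite_Union_empty:
  fixes \<A> :: "'a::topological_space set set"
  shows "finite \<A> \<Longrightarrow> (\<And>S. S \<in> \<A> \<Longrightarrow> closed S \<and> interior S = {}) \<Longrightarrow> interior (\<Union>\<A>) = {}"
proof (induction \<A> rule: finite_induct)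
  case (insert S \<A>)
  then show ?case
    using interior_closed_Un_empty_interior[of S "\<Union>\<A>"] by auto
qed auto

text \<open>The drawing has empty interior, so faces accumulate at every point; as there are only
  finitely many, a single one accumulates at the vertex.\<close>

lemma vertex_on_face:
  assumes fin: "finite V" and sg: "simple_graph V E" and pe: "planar_embedding V E \<phi> \<gamma>" and i: "i \<in> V"
  shows "incident_faces V E \<phi> \<gamma> i \<noteq> {}"
proof -
  have finE: "finite E" using fin sg by (rule finite_edges)
  note p = pieces_props[OF pe order_refl fin finE]
  have "interior (drawing V E \<phi> \<gamma>) = {}"
    unfolding drawing_pieces using p by (intro interior_finite_Union_empty) (auto simp: compact_imp_closed)
  then have "closure (- drawing V E \<phi> \<gamma>) = UNIV"
    by (simp add: closure_interior)
  moreover have "- drawing V E \<phi> \<gamma> = \<Union>(faces V E \<phi> \<gamma>)"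
    by (simp add: faces_def)
  moreover have "closure (\<Union>(faces V E \<phi> \<gamma>)) \<subseteq> \<Union>(closure ` faces V E \<phi> \<gamma>)"
  proof (intro closure_minimal closed_UN ballI closed_closure finite_faces[OF fin sg pe])
    show "\<Union>(faces V E \<phi> \<gamma>) \<subseteq> \<Union>(closure ` faces V E \<phi> \<gamma>)"
      using closure_subset by blast
  qed
  ultimately have "\<phi> i \<in> \<Union>(closure ` faces V E \<phi> \<gamma>)" by auto
  then obtain f where "f \<in> faces V E \<phi> \<gamma>" "\<phi> i \<in> closure f" by blast
  then show ?thesis
    using vertex_in_frontier[OF pe fin finE _ i] by (auto simp: incident_faces_def)
qed

subsection \<open>Outer-planar graphs\<close>

lemma planar_embeddingD:
  assumes "planar_embedding W F \<phi> \<gamma>"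
  shows "inj_on \<phi> W" "e \<in> F \<Longrightarrow> arc (\<gamma> e)"
    "e \<in> F \<Longrightarrow> {pathstart (\<gamma> e), pathfinish (\<gamma> e)} = \<phi> ` e"
    "e \<in> F \<Longrightarrow> path_image (\<gamma> e) \<inter> \<phi> ` W = \<phi> ` e"
    "e \<in> F \<Longrightarrow> e' \<in> F \<Longrightarrow> e \<noteq> e' \<Longrightarrow> path_image (\<gamma> e) \<inter> path_image (\<gamma> e') = \<phi> ` (e \<inter> e')"
  using assms unfolding planar_embedding_def by simp_all

text \<open>\<open>U\<close> stands in for the outer face. Not being required to be a full
  component, it can be kept unchanged when vertices are deleted or suppressed.\<close>

definition outer_drawn ::
    "'v set \<Rightarrow> 'v set set \<Rightarrow> ('v \<Rightarrow> complex) \<Rightarrow> ('v set \<Rightarrow> real \<Rightarrow> complex) \<Rightarrow> complex set \<Rightarrow> bool" where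
  "outer_drawn W F \<phi> \<gamma> U \<longleftrightarrow> simple_graph W F \<and> planar_embedding W F \<phi> \<gamma> \<and>
     connected U \<and> U \<inter> drawing W F \<phi> \<gamma> = {} \<and> \<phi> ` W \<subseteq> closure U"

lemma outer_planar_imp_outer_drawn:
  assumes "outer_planar W F" "simple_graph W F"
  obtains \<phi> \<gamma> U where "outer_drawn W F \<phi> \<gamma> U"
proof -
  obtain \<phi> \<gamma> f where *: "planar_embedding W F \<phi> \<gamma>" "f \<in> faces W F \<phi> \<gamma>" "\<forall>i\<in>W. \<phi> i \<in> frontier f"
    using assms by (auto simp: outer_planar_def)
  have "outer_drawn W F \<phi> \<gamma> f"
    using * assms(2) in_components_connected[of f] in_components_subset[of f]
    by (fastforce simp: outer_drawn_def faces_def frontier_def)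
  then show thesis by (rule that)
qed

section \<open>Paths of a drawn graph as arcs\<close>

fun path_edges :: "'v list \<Rightarrow> 'v set set" where
  "path_edges (x # y # xs) = insert {x, y} (path_edges (y # xs))"
| "path_edges _ = {}"

definition region :: "('v set \<Rightarrow> real \<Rightarrow> complex) \<Rightarrow> 'v list \<Rightarrow> complex set" where
  "region \<gamma> xs = (\<Union>e\<in>path_edges xs. path_image (\<gamma> e))"

lemma Union_path_edges: "2 \<le> length xs \<Longrightarrow> \<Union>(path_edges xs) = set xs"
proof (induction xs rule: path_edges.induct)
  case (1 x y xs)
  then show ?case by (cases xs) auto
qed auto

lemma path_edges_subset: "successively (\<lambda>u v. {u, v} \<in> F) xs \<Longrightarrow> path_edges xs \<subseteq> F"
  by (induction xs rule: path_edges.induct) auto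

text \<open>Paths with at most one common vertex have no common edge, so their arcs meet only in
  images of vertices.\<close>

lemma region_Int:
  assumes pe: "planar_embedding W F \<phi> \<gamma>" and sg: "simple_graph W F"
    and F: "path_edges xs \<subseteq> F" "path_edges ys \<subseteq> F" "2 \<le> length xs" "2 \<le> length ys"
    and p: "set xs \<inter> set ys \<subseteq> {p}"
  shows "region \<gamma> xs \<inter> region \<gamma> ys = \<phi> ` (set xs \<inter> set ys)"
proof -
  have ne: "e \<noteq> e'" if "e \<in> path_edges xs" "e' \<in> path_edges ys" for e e'
  proof
    assume "e = e'"
    then have "e \<subseteq> {p}"
      using that p Union_path_edges F(3,4) by blast
    moreover have "card e = 2"
      using that F(1) sg by (auto simp: simple_graph_def)
    ultimately show False
      using card_mono[of "{p}" e] by simp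
  qed
  have int: "path_image (\<gamma> e) \<inter> path_image (\<gamma> e') = \<phi> ` (e \<inter> e')"
    if "e \<in> path_edges xs" "e' \<in> path_edges ys" for e e'
    using that F(1,2) ne[OF that] by (intro planar_embeddingD(5)[OF pe]) auto
  have "region \<gamma> xs \<inter> region \<gamma> ys =
      (\<Union>e\<in>path_edges xs. \<Union>e'\<in>path_edges ys. path_image (\<gamma> e) \<inter> path_image (\<gamma> e'))"
    unfolding region_def by blast
  also have "\<dots> = (\<Union>e\<in>path_edges xs. \<Union>e'\<in>path_edges ys. \<phi> ` (e \<inter> e'))"
    using int by simp
  also have "\<dots> = \<phi> ` (\<Union>(path_edges xs) \<inter> \<Union>(path_edges ys))" by blast
  finally show ?thesis using Union_path_edges F(3,4) by metis
qed

lemma region_arc: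
  assumes pe: "planar_embedding W F \<phi> \<gamma>" and sg: "simple_graph W F"
  shows "distinct xs \<Longrightarrow> successively (\<lambda>u v. {u, v} \<in> F) xs \<Longrightarrow> 2 \<le> length xs \<Longrightarrow>
    arc_between (\<phi> (hd xs)) (\<phi> (last xs)) (region \<gamma> xs)"
proof (induction xs rule: path_edges.induct)
  case (1 x y xs)
  have edge: "arc_between (\<phi> x) (\<phi> y) (path_image (\<gamma> {x, y}))"
  proof -
    have e: "{x, y} \<in> F" using 1 by simp
    obtain a b where ab: "arc_between a b (path_image (\<gamma> {x, y}))" "{a, b} = \<phi> ` {x, y}"
    proof (rule that)
      show "arc_between (pathstart (\<gamma> {x, y})) (pathfinish (\<gamma> {x, y})) (path_image (\<gamma> {x, y}))"
        unfolding arc_between_def using planar_embeddingD(2)[OF pe e] by blast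
    qed (rule planar_embeddingD(3)[OF pe e])
    then have "a = \<phi> x \<and> b = \<phi> y \<or> a = \<phi> y \<and> b = \<phi> x"
      by (auto simp: doubleton_eq_iff)
    then show ?thesis using ab(1) arc_between_sym by blast
  qed
  show ?case
  proof (cases xs)
    case Nil
    then show ?thesis using edge by (simp add: region_def)
  next
    case (Cons z zs)
    have F: "path_edges [x, y] \<subseteq> F" "path_edges (y # xs) \<subseteq> F"
      using 1 path_edges_subset[of F "y # xs"] by auto
    have "region \<gamma> [x, y] \<inter> region \<gamma> (y # xs) = \<phi> ` (set [x, y] \<inter> set (y # xs))"
      using 1 Cons by (intro region_Int[OF pe sg F, of y]) auto
    also have "\<dots> = {\<phi> y}"
      using 1 by auto
    finally have "path_image (\<gamma> {x, y}) \<inter> region \<gamma> (y # xs) = {\<phi> y}"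
      by (simp add: region_def)
    moreover have "arc_between (\<phi> y) (\<phi> (last (y # xs))) (region \<gamma> (y # xs))"
      using 1 Cons by auto
    ultimately have "arc_between (\<phi> x) (\<phi> (last (y # xs))) (path_image (\<gamma> {x, y}) \<union> region \<gamma> (y # xs))"
      using edge arc_between_join by blast
    then show ?thesis by (simp add: region_def)
  qed
qed auto

text \<open>Paths are lists of indices into an injective family \<open>f\<close> of vertices, so that intersections
  of paths reduce to arithmetic.\<close>

definition index_path :: "'v set set \<Rightarrow> (nat \<Rightarrow> 'v) \<Rightarrow> nat \<Rightarrow> nat \<Rightarrow> nat \<Rightarrow> nat list \<Rightarrow> bool" where
  "index_path F f n a b is \<longleftrightarrow> distinct is \<and> set is \<subseteq> {..<n} \<and> 2 \<le> length is \<and>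
     successively (\<lambda>i j. {f i, f j} \<in> F) is \<and> hd is = a \<and> last is = b"

text \<open>Injectivity of \<open>f\<close> and the embedding transfer the intersections of index
  lists to the arcs, which gives a drawing of the complete graph with all branch points in the
  closure of \<open>U\<close>.\<close>

lemma no_K4_subdivision:
  assumes od: "outer_drawn W F \<phi> \<gamma> U" and f: "inj_on f {..<n}" "f ` {..<n} \<subseteq> W"
    and P: "index_path F f n a b AB" "index_path F f n a c AC" "index_path F f n a d AD"
      "index_path F f n b c BC" "index_path F f n b d BD" "index_path F f n c d CD"
    and I: "set AB \<inter> set AC = {a}" "set AB \<inter> set AD = {a}" "set AC \<inter> set AD = {a}"
      "set AB \<inter> set BC = {b}" "set AB \<inter> set BD = {b}" "set BC \<inter> set BD = {b}"
      "set AC \<inter> set BC = {c}" "set AC \<inter> set CD = {c}" "set BC \<inter> set CD = {c}"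
      "set AD \<inter> set BD = {d}" "set AD \<inter> set CD = {d}" "set BD \<inter> set CD = {d}"
      "set AB \<inter> set CD = {}" "set AC \<inter> set BD = {}" "set AD \<inter> set BC = {}"
  shows False
proof -
  have pe: "planar_embedding W F \<phi> \<gamma>" and sg: "simple_graph W F"
    using od by (auto simp: outer_drawn_def)
  define R where "R is = region \<gamma> (map f is)" for "is"
  have suc: "successively (\<lambda>u v. {u, v} \<in> F) (map f is)" if "index_path F f n u v is" for u v "is"
    using that by (simp add: index_path_def successively_map)
  have arc: "arc_between (\<phi> (f u)) (\<phi> (f v)) (R is)" if "index_path F f n u v is" for u v "is"
  proof -
    have "is \<noteq> []" using that by (auto simp: index_path_def)
    moreover have "distinct (map f is)"
      using that inj_on_subset[OF f(1), of "set is"] by (simp add: index_path_def distinct_map)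
    ultimately show ?thesis
      using region_arc[OF pe sg _ suc[OF that]] that
      by (simp add: R_def index_path_def hd_map last_map)
  qed
  have int: "R is \<inter> R js = (\<lambda>i. \<phi> (f i)) ` X"
    if "set is \<inter> set js = X" "X \<subseteq> {p}" "index_path F f n u v is" "index_path F f n u' v' js" for "is" js p u v u' v' X
  proof -
    have eq: "set (map f is) \<inter> set (map f js) = f ` X"
      unfolding that(1)[symmetric] set_map
      by (rule inj_on_image_Int[OF f(1), symmetric]) (use that(3,4) in \<open>simp_all add: index_path_def\<close>)
    have "set (map f is) \<inter> set (map f js) \<subseteq> {f p}"
      unfolding eq using that(2) by blast
    moreover have "2 \<le> length (map f is)" "2 \<le> length (map f js)"
      using that(3,4) by (simp_all add: index_path_def)
    ultimately have "R is \<inter> R js = \<phi> ` (set (map f is) \<inter> set (map f js))"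
      unfolding R_def using path_edges_subset[OF suc[OF that(3)]] path_edges_subset[OF suc[OF that(4)]]
      by (intro region_Int[OF pe sg])
    then show ?thesis unfolding eq by (simp add: image_image)
  qed
  have int1: "R is \<inter> R js = {\<phi> (f p)}"
    if "set is \<inter> set js = {p}" "index_path F f n u v is" "index_path F f n u' v' js" for "is" js p u v u' v'
    using int[OF that(1) _ that(2,3), of p] by simp
  have int0: "R is \<inter> R js = {}"
    if "set is \<inter> set js = {}" "index_path F f n u v is" "index_path F f n u' v' js" for "is" js u v u' v'
    using int[OF that(1) _ that(2,3)] by simp
  have K: "K4_drawing (\<phi> (f a)) (\<phi> (f b)) (\<phi> (f c)) (\<phi> (f d)) (R AB) (R AC) (R AD) (R BC) (R BD) (R CD)"
    unfolding K4_drawing_def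
    by (intro conjI arc[OF P(1)] arc[OF P(2)] arc[OF P(3)] arc[OF P(4)] arc[OF P(5)] arc[OF P(6)]
      int1[OF I(1) P(1,2)] int1[OF I(2) P(1,3)] int1[OF I(3) P(2,3)] int1[OF I(4) P(1,4)]
      int1[OF I(5) P(1,5)] int1[OF I(6) P(4,5)] int1[OF I(7) P(2,4)] int1[OF I(8) P(2,6)]
      int1[OF I(9) P(4,6)] int1[OF I(10) P(3,5)] int1[OF I(11) P(3,6)] int1[OF I(12) P(5,6)]
      int0[OF I(13) P(1,6)] int0[OF I(14) P(2,5)] int0[OF I(15) P(3,4)])
  have "R is \<subseteq> drawing W F \<phi> \<gamma>" if "index_path F f n u v is" for u v "is"
    using path_edges_subset[OF suc[OF that]] by (auto simp: R_def region_def drawing_def)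
  from this[OF P(1)] this[OF P(2)] this[OF P(3)] this[OF P(4)] this[OF P(5)] this[OF P(6)]
  have "U \<inter> (R AB \<union> R AC \<union> R AD \<union> R BC \<union> R BD \<union> R CD) = {}"
    using od unfolding outer_drawn_def by blast
  moreover have "set AB \<subseteq> {..<n}" "set CD \<subseteq> {..<n}"
    using P(1,6) by (simp_all add: index_path_def)
  then have "{a, b, c, d} \<subseteq> {..<n}"
    using I(1,4,8,11) by blast
  then have "{\<phi> (f a), \<phi> (f b), \<phi> (f c), \<phi> (f d)} \<subseteq> closure U"
    using od f(2) unfolding outer_drawn_def by blast
  ultimately show False
    using K4_not_outerplanar[OF K] od by (auto simp: outer_drawn_def)
qed

definition neighbours :: "'v set set \<Rightarrow> 'v \<Rightarrow> 'v set" where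
  "neighbours F v = {u. {v, u} \<in> F}"

lemma neighbours_subset:
  assumes "simple_graph W F"
  shows "neighbours F v \<subseteq> W - {v}"
proof -
  have "u \<in> W - {v}" if "{v, u} \<in> F" for u
  proof -
    have "{v, u} \<subseteq> W" "card {v, u} = 2"
      using assms that unfolding simple_graph_def by blast+
    then show ?thesis by (cases "u = v") auto
  qed
  then show ?thesis by (auto simp: neighbours_def)
qed

lemma ex_third_element:
  assumes "3 \<le> card A"
  obtains z where "z \<in> A" "z \<noteq> x" "z \<noteq> y"
proof -
  have "\<not> A \<subseteq> {x, y}"
    using assms card_mono[of "{x, y}" A] by (auto simp: card_insert_if split: if_splits)
  then show thesis using that by blast
qed

text \<open>In a longest path \<open>x\<^sub>0 x\<^sub>1 \<dots>\<close> whose first vertex has its second neighbour \<open>x\<^sub>a\<close> as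
  early as possible, rotating the path at \<open>x\<^sub>a\<close> yields another longest path, starting at
  \<open>x\<^bsub>a-1\<^esub>\<close>. By minimality of \<open>a\<close> the third neighbours of \<open>x\<^sub>0\<close> and \<open>x\<^bsub>a-1\<^esub>\<close> both lie beyond \<open>x\<^sub>a\<close>,
  which produces a subdivision of the complete graph on four vertices.\<close>

lemma outer_drawn_degree_le_2:
  assumes od: "outer_drawn W F \<phi> \<gamma> U" and W: "finite W" "W \<noteq> {}"
  shows "\<exists>v\<in>W. card (neighbours F v) \<le> 2"
proof (rule ccontr)
  assume neg: "\<not> ?thesis"
  have deg: "3 \<le> card (neighbours F v)" if "v \<in> W" for v
  proof -
    have "\<not> card (neighbours F v) \<le> 2" using neg that by blast
    then show ?thesis by simp
  qed
  have sg: "simple_graph W F" using od by (auto simp: outer_drawn_def)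
  define E where "E = (\<lambda>u v. {u, v} \<in> F)"
  have E_sym: "E u v \<Longrightarrow> E v u" for u v by (simp add: E_def insert_commute)
  have nb: "u \<in> neighbours F v \<longleftrightarrow> E v u" for u v by (simp add: neighbours_def E_def)
  have E_W: "u \<in> W" "u \<noteq> v" if "E v u" for u v
    using neighbours_subset[OF sg, of v] that unfolding nb[symmetric] by blast+
  define L where "L = {xs. xs \<noteq> [] \<and> distinct xs \<and> set xs \<subseteq> W \<and> successively E xs}"
  define n where "n = Max (length ` L)"
  have bd: "length xs \<le> card W" if "xs \<in> L" for xs
    using that card_mono[OF W(1), of "set xs"] by (auto simp: L_def distinct_card)
  have fin: "finite (length ` L)"
    by (rule finite_subset[of _ "{..card W}"]) (use bd in auto)
  obtain w where "w \<in> W" using W by blast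
  then have "[w] \<in> L" by (simp add: L_def)
  then have "n \<in> length ` L" unfolding n_def using fin by (intro Max_in) auto
  have max: "length xs \<le> n" if "xs \<in> L" for xs
    unfolding n_def using fin that by (intro Max_ge) auto
  define M where "M = {xs \<in> L. length xs = n}"
  \<comment> \<open>A neighbour off the path would extend it, so a longest path contains all
    neighbours of its first vertex.\<close>
  have nbr: "\<exists>k. 1 \<le> k \<and> k < n \<and> u = xs ! k" if xs: "xs \<in> M" and u: "E (xs ! 0) u" for xs u
  proof -
    have ne: "xs \<noteq> []" "length xs = n" using xs by (auto simp: M_def L_def)
    have "u \<in> set xs"
    proof (rule ccontr)
      assume "u \<notin> set xs"
      then have "u # xs \<in> L"
        using xs E_sym[OF u] E_W[OF u] ne by (auto simp: M_def L_def successively_Cons hd_conv_nth)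
      from max[OF this] show False using ne by simp
    qed
    then obtain k where k: "k < n" "u = xs ! k" using ne by (auto simp: in_set_conv_nth)
    moreover have "k \<noteq> 0" using k(2) E_W(2)[OF u] by (cases "k = 0") auto
    ultimately show ?thesis by (intro exI[of _ k]) auto
  qed
  \<comment> \<open>\<open>2 \<le> a\<close> excludes the successor on the path, so
    \<open>xs ! a\<close> is a second neighbour of the first vertex.\<close>
  define Q where "Q a \<longleftrightarrow> (\<exists>xs\<in>M. 2 \<le> a \<and> a < n \<and> E (xs ! 0) (xs ! a))" for a
  have "\<exists>a. Q a"
  proof -
    obtain xs where xs: "xs \<in> M" using \<open>n \<in> length ` L\<close> by (auto simp: M_def)
    then have "xs ! 0 \<in> W" by (auto simp: M_def L_def)
    from ex_third_element[OF deg[OF this]] obtain u where u: "E (xs ! 0) u" "u \<noteq> xs ! 1"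
      unfolding nb by metis
    obtain k where "1 \<le> k" "k < n" "u = xs ! k" using nbr[OF xs u(1)] by blast
    moreover then have "k \<noteq> 1" using u(2) by blast
    ultimately have "Q k" unfolding Q_def using xs u(1) by (intro bexI[of _ xs]) auto
    then show ?thesis by blast
  qed
  define a where "a = (LEAST a. Q a)"
  have "Q a" unfolding a_def using \<open>\<exists>a. Q a\<close> by (rule LeastI_ex)
  have a_min: "a \<le> k" if "Q k" for k unfolding a_def using that by (rule Least_le)
  obtain xs where xs: "xs \<in> M" "2 \<le> a" "a < n" "E (xs ! 0) (xs ! a)"
    using \<open>Q a\<close> by (auto simp: Q_def)
  define f where "f = (!) xs"
  have xsL: "xs \<noteq> []" "distinct xs" "set xs \<subseteq> W" "successively E xs" "length xs = n"
    using xs(1) by (auto simp: M_def L_def)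
  have inj: "inj_on f {..<n}"
    using xsL by (auto simp: f_def inj_on_def nth_eq_iff_index_eq)
  have fW: "f ` {..<n} \<subseteq> W" using xsL by (auto simp: f_def)
  have suc: "E (f k) (f (Suc k))" if "Suc k < n" for k
    using successively_nth[OF xsL(4), of k] that xsL(5) by (simp add: f_def)
  obtain z where z: "E (f 0) z" "z \<noteq> f 1" "z \<noteq> f a"
  proof -
    have "f 0 \<in> W" using fW xs(3) by auto
    from ex_third_element[OF deg[OF this]] show thesis using that unfolding nb by metis
  qed
  obtain b where b: "1 \<le> b" "b < n" "z = f b"
    using nbr[OF xs(1), of z] z(1) by (auto simp: f_def)
  have "b \<noteq> 1" "b \<noteq> a" using b z by auto
  then have "Q b"
    unfolding Q_def using xs(1) b z(1) by (intro bexI[of _ xs]) (auto simp: f_def)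
  then have ab: "a < b" using a_min[of b] \<open>b \<noteq> a\<close> by simp
  have fb: "E (f 0) (f b)" and fa: "E (f 0) (f a)" using z b xs by (auto simp: f_def)
  \<comment> \<open>The rotation uses the edge from \<open>xs ! 0\<close> to \<open>xs ! a\<close>;
    its first vertex is the old one at index \<open>a - 1\<close>.\<close>
  define ys where "ys = rev (take a xs) @ drop a xs"
  have ysM: "ys \<in> M"
  proof -
    have t: "take a xs \<noteq> []" "drop a xs \<noteq> []" using xs xsL by auto
    have "successively E (take a xs)" "successively E (drop a xs)"
      using xsL(4) successively_append_iff[of E "take a xs" "drop a xs"] by simp_all
    moreover have "successively E (rev (take a xs))"
      unfolding successively_rev
      by (rule successively_mono[OF \<open>successively E (take a xs)\<close>]) (rule E_sym)
    moreover have "E (last (rev (take a xs))) (hd (drop a xs))"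
      using xs(2-4) xsL(1,5) by (simp add: last_rev hd_drop_conv_nth hd_conv_nth)
    ultimately have "successively E ys"
      unfolding ys_def successively_append_iff using t by simp
    moreover have "distinct (take a xs @ drop a xs)" "set (take a xs @ drop a xs) \<subseteq> W"
      using xsL by simp_all
    then have "distinct ys" "set ys \<subseteq> W"
      unfolding ys_def distinct_append set_append by simp_all
    ultimately show ?thesis
      using xsL xs t by (simp add: M_def L_def ys_def)
  qed
  have ys_nth: "ys ! k = f (a - 1 - k)" if "k < a" for k
    using that xs(3) xsL(5) by (simp add: ys_def f_def nth_append rev_nth)
  have ys_nth': "ys ! k = f k" if "a \<le> k" "k < n" for k
    using that xs(3) xsL(5) by (simp add: ys_def f_def nth_append)
  obtain u where u: "E (ys ! 0) u" "u \<noteq> f (a - 2)" "u \<noteq> f a"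
  proof -
    have "ys ! 0 \<in> W" using fW ys_nth[of 0] xs(2,3) by auto
    from ex_third_element[OF deg[OF this]] show thesis using that unfolding nb by metis
  qed
  obtain k where k: "1 \<le> k" "k < n" "u = ys ! k"
    using nbr[OF ysM u(1)] by blast
  \<comment> \<open>The choice of \<open>u\<close> excludes the indices 1 and \<open>a\<close> of
    the rotated path; an index in between would contradict the minimality of
    \<open>a\<close>.\<close>
  have "a < k"
  proof (rule ccontr)
    assume "\<not> a < k"
    moreover have "k \<noteq> a" using u(3) k ys_nth'[of a] by auto
    ultimately have "k < a" by simp
    moreover have "k \<noteq> 1" using u(2) k \<open>k < a\<close> ys_nth[of k] by (auto simp: numeral_2_eq_2)
    ultimately have "Q k" unfolding Q_def using ysM u(1) k by (intro bexI[of _ ys]) auto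
    then show False using a_min[of k] \<open>k < a\<close> by simp
  qed
  then have fk: "E (f (a - 1)) (f k)"
    using u(1) k ys_nth[of 0] ys_nth'[of k] xs(2) by simp
  define seg where "seg i j = [i..<Suc j]" for i j :: nat
  have seg: "successively (\<lambda>i j. E (f i) (f j)) (seg i j)" if "j < n" for i j
    using that suc by (auto simp: seg_def successively_conv_nth simp del: upt_Suc)
  have revseg: "successively (\<lambda>i j. E (f i) (f j)) (rev (seg i j))" if "j < n" for i j
    unfolding successively_rev by (rule successively_mono[OF seg[OF that]]) (rule E_sym)
  have P: "index_path F f n i j (seg i j)" if "i < j" "j < n" for i j
    using seg[OF that(2)] that by (auto simp: index_path_def E_def seg_def simp del: upt_Suc)
  have edge: "index_path F f n i j [i, j]" if "i \<noteq> j" "i < n" "j < n" "E (f i) (f j)" for i j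
    using that by (auto simp: index_path_def E_def)
  have ear: "index_path F f n l i (l # rev (seg i j))"
    if "i \<le> j" "j < n" "l < i" "E (f l) (f j)" for i j l
    using revseg[OF that(2)] that
    by (auto simp: index_path_def E_def seg_def successively_Cons hd_rev last_rev simp del: upt_Suc)
  \<comment> \<open>Branch points are the indices 0, \<open>a - 1\<close>, \<open>a\<close> and the
    smaller of \<open>k\<close> and \<open>b\<close>. The edge to the larger one is prolonged back
    along the path to the smaller one (\<open>ear\<close>). \<open>2 \<le> a\<close> keeps 0 and
    \<open>a - 1\<close> apart.\<close>
  show False
  proof (cases "k \<le> b")
    case True
    show False
      by (rule no_K4_subdivision[OF od inj fW P[of 0 "a - 1"] edge[OF _ _ _ fa] ear[of k b 0]
          edge[of "a - 1" a] edge[OF _ _ _ fk] P[of a k]])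
        (use True \<open>a < k\<close> \<open>a < b\<close> xs(2,3) k b fb suc[of "a - 1"] in \<open>auto simp: seg_def simp del: upt_Suc\<close>)
  next
    case False
    show False
      by (rule no_K4_subdivision[OF od inj fW P[of 0 "a - 1"] edge[OF _ _ _ fa] edge[OF _ _ _ fb]
          edge[of "a - 1" a] ear[of b k "a - 1"] P[of a b]])
        (use False \<open>a < k\<close> \<open>a < b\<close> xs(2,3) k b fk suc[of "a - 1"] in \<open>auto simp: seg_def simp del: upt_Suc\<close>)
  qed
qed

section \<open>Deleting and suppressing a vertex of an outer-planar drawing\<close>

lemma outer_drawn_delete:
  assumes od: "outer_drawn W F \<phi> \<gamma> U"
  shows "outer_drawn (W - {v}) {e \<in> F. v \<notin> e} \<phi> \<gamma> U"
proof -
  have sg: "simple_graph W F" and pe: "planar_embedding W F \<phi> \<gamma>"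
    using od by (auto simp: outer_drawn_def)
  note pe_props = planar_embeddingD[OF pe]
  have *: "path_image (\<gamma> e) \<inter> \<phi> ` (W - {v}) = \<phi> ` e" if e: "e \<in> F" "v \<notin> e" for e
  proof -
    have "e \<subseteq> W - {v}" using sg e by (auto simp: simple_graph_def)
    then have "\<phi> ` e \<subseteq> \<phi> ` (W - {v})" "\<phi> ` (W - {v}) \<subseteq> \<phi> ` W" by blast+
    then show ?thesis using pe_props(4)[OF e(1)] by blast
  qed
  have "inj_on \<phi> (W - {v})"
    using pe_props(1) by (rule inj_on_subset) blast
  then have "planar_embedding (W - {v}) {e \<in> F. v \<notin> e} \<phi> \<gamma>"
    unfolding planar_embedding_def using pe_props * by simp
  moreover have "simple_graph (W - {v}) {e \<in> F. v \<notin> e}"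
    using sg unfolding simple_graph_def by blast
  moreover have "drawing (W - {v}) {e \<in> F. v \<notin> e} \<phi> \<gamma> \<subseteq> drawing W F \<phi> \<gamma>"
    unfolding drawing_def by blast
  ultimately show ?thesis
    using od unfolding outer_drawn_def by blast
qed

text \<open>The new edge is drawn along the two edges at \<open>v\<close>. The drawing gains no
  point, so \<open>U\<close> remains valid; if \<open>i\<close> and \<open>j\<close> are already
  adjacent, deleting \<open>v\<close> is enough.\<close>

lemma outer_drawn_suppress:
  assumes od: "outer_drawn W F \<phi> \<gamma> U" and ij: "i \<noteq> j" "{i, v} \<in> F" "{v, j} \<in> F"
  shows "\<exists>\<gamma>'. outer_drawn (W - {v}) (insert {i, j} {e \<in> F. v \<notin> e}) \<phi> \<gamma>' U"
proof (cases "{i, j} \<in> F")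
  have sg: "simple_graph W F" and pe: "planar_embedding W F \<phi> \<gamma>"
    using od by (auto simp: outer_drawn_def)
  have "i \<in> neighbours F v" "v \<in> neighbours F i" "j \<in> neighbours F v"
    using ij by (simp_all add: neighbours_def insert_commute)
  then have v: "i \<noteq> v" "j \<noteq> v" "i \<in> W" "j \<in> W" "v \<in> W"
    using neighbours_subset[OF sg] by blast+
  case True
  then have "insert {i, j} {e \<in> F. v \<notin> e} = {e \<in> F. v \<notin> e}" using v by auto
  then show ?thesis using outer_drawn_delete[OF od] by metis
next
  have sg: "simple_graph W F" and pe: "planar_embedding W F \<phi> \<gamma>"
    using od by (auto simp: outer_drawn_def)
  have "i \<in> neighbours F v" "v \<in> neighbours F i" "j \<in> neighbours F v"
    using ij by (simp_all add: neighbours_def insert_commute)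
  then have v: "i \<noteq> v" "j \<noteq> v" "i \<in> W" "j \<in> W" "v \<in> W"
    using neighbours_subset[OF sg] by blast+
  case False
  let ?F = "{e \<in> F. v \<notin> e}"
  have del: "outer_drawn (W - {v}) ?F \<phi> \<gamma> U" by (rule outer_drawn_delete[OF od])
  have "arc_between (\<phi> i) (\<phi> j) (region \<gamma> [i, v, j])"
    using region_arc[OF pe sg, of "[i, v, j]"] ij v by auto
  then obtain h where h: "arc h" "pathstart h = \<phi> i" "pathfinish h = \<phi> j"
    "path_image h = path_image (\<gamma> {i, v}) \<union> path_image (\<gamma> {v, j})"
    by (auto simp: arc_between_def region_def)
  have pi: "path_image (\<gamma> {i, v}) \<inter> \<phi> ` W = \<phi> ` {i, v}" "path_image (\<gamma> {v, j}) \<inter> \<phi> ` W = \<phi> ` {v, j}"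
    using planar_embeddingD(4)[OF pe] ij by blast+
  have inj: "inj_on \<phi> W" by (rule planar_embeddingD(1)[OF pe])
  have \<phi>: "\<phi> i \<noteq> \<phi> v" "\<phi> j \<noteq> \<phi> v"
    using inj v by (auto dest: inj_onD)
  have \<phi>W: "\<phi> ` (W - {v}) = \<phi> ` W - {\<phi> v}"
    using inj_on_image_set_diff[OF inj, of W "{v}"] v(5) by simp
  have h_vertices: "path_image h \<inter> \<phi> ` (W - {v}) = \<phi> ` {i, j}"
  proof -
    have "path_image h \<inter> \<phi> ` (W - {v}) = (path_image h \<inter> \<phi> ` W) - {\<phi> v}"
      unfolding \<phi>W by blast
    also have "\<dots> = {\<phi> i, \<phi> v, \<phi> j} - {\<phi> v}"
      unfolding h(4) Int_Un_distrib2 pi by auto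
    also have "\<dots> = \<phi> ` {i, j}"
      using \<phi> by auto
    finally show ?thesis .
  qed
  have h_edges: "path_image h \<inter> path_image (\<gamma> e) = \<phi> ` ({i, j} \<inter> e)" if e: "e \<in> ?F" for e
  proof -
    have "path_image (\<gamma> {i, v}) \<inter> path_image (\<gamma> e) = \<phi> ` ({i, v} \<inter> e)"
      "path_image (\<gamma> {v, j}) \<inter> path_image (\<gamma> e) = \<phi> ` ({v, j} \<inter> e)"
      by (rule planar_embeddingD(5)[OF pe]; use e ij in auto)+
    then show ?thesis using e unfolding h(4) Int_Un_distrib2 by auto
  qed
  define \<gamma>' where "\<gamma>' = \<gamma>({i, j} := h)"
  have \<gamma>': "\<gamma>' {i, j} = h" "\<And>e. e \<in> ?F \<Longrightarrow> \<gamma>' e = \<gamma> e"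
    using False by (auto simp: \<gamma>'_def)
  have pe': "planar_embedding (W - {v}) ?F \<phi> \<gamma>" using del by (simp add: outer_drawn_def)
  have h_edges': "path_image (\<gamma> e) \<inter> path_image h = \<phi> ` (e \<inter> {i, j})" if "e \<in> ?F" for e
    using h_edges[OF that] by (simp only: Int_commute)
  have "planar_embedding (W - {v}) (insert {i, j} ?F) \<phi> \<gamma>'"
    unfolding planar_embedding_def
  proof (intro conjI ballI impI)
    show "inj_on \<phi> (W - {v})" using pe' by (simp add: planar_embedding_def)
    fix e assume e: "e \<in> insert {i, j} ?F"
    then consider "e = {i, j}" | "e \<in> ?F" by blast
    note e_cases = this
    show "arc (\<gamma>' e)" "{pathstart (\<gamma>' e), pathfinish (\<gamma>' e)} = \<phi> ` e"
      "path_image (\<gamma>' e) \<inter> \<phi> ` (W - {v}) = \<phi> ` e"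
      by (rule e_cases; use planar_embeddingD(2-4)[OF pe', of e] h h_vertices in \<open>simp add: \<gamma>'\<close>)+
    fix e' assume e': "e' \<in> insert {i, j} ?F" and ne: "e \<noteq> e'"
    then consider "e' = {i, j}" "e \<in> ?F" | "e' \<in> ?F" "e = {i, j}" | "e \<in> ?F" "e' \<in> ?F"
      using e by blast
    then show "path_image (\<gamma>' e) \<inter> path_image (\<gamma>' e') = \<phi> ` (e \<inter> e')"
    proof cases
      case 1 then show ?thesis using h_edges' by (simp only: \<gamma>')
    next
      case 2 then show ?thesis using h_edges by (simp only: \<gamma>')
    next
      case 3 then show ?thesis using planar_embeddingD(5)[OF pe' 3 ne] by (simp only: \<gamma>')
    qed
  qed
  moreover have "simple_graph (W - {v}) (insert {i, j} ?F)"
    using sg v ij by (auto simp: simple_graph_def)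
  moreover have "drawing (W - {v}) (insert {i, j} ?F) \<phi> \<gamma>' \<subseteq> drawing W F \<phi> \<gamma>"
  proof -
    have "path_image (\<gamma>' e) \<subseteq> drawing W F \<phi> \<gamma>" if "e \<in> insert {i, j} ?F" for e
    proof (cases "e = {i, j}")
      case True
      then show ?thesis using ij unfolding \<open>e = _\<close> \<gamma>' h(4) drawing_def by blast
    next
      case False
      then have "e \<in> ?F" using that by blast
      then show ?thesis unfolding \<gamma>'(2)[OF \<open>e \<in> ?F\<close>] drawing_def by blast
    qed
    then show ?thesis unfolding drawing_def[of "W - {v}"] by (auto simp: drawing_def)
  qed
  ultimately show ?thesis
    using od unfolding outer_drawn_def by blast
qed

subsection \<open>Eliminating vertices of degree at most two\<close>

text \<open>The semimetric polytope on \<open>V\<close> and an apex, with \<open>m i\<close> the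
  distance of \<open>i\<close> to the apex: triangle inequalities, and perimeter at most 2. Since
  \<open>{i, i}\<close> is \<open>{i}\<close>, the condition \<open>D {i} = 0\<close> takes care of
  repeated points.\<close>

definition cut_metric :: "'v set \<Rightarrow> ('v set \<Rightarrow> real) \<Rightarrow> ('v \<Rightarrow> real) \<Rightarrow> bool" where
  "cut_metric V D m \<longleftrightarrow>
     (\<forall>i\<in>V. 0 \<le> m i \<and> m i \<le> 1 \<and> D {i} = 0) \<and>
     (\<forall>i\<in>V. \<forall>j\<in>V. m i - m j \<le> D {i, j} \<and> D {i, j} \<le> m i + m j \<and> D {i, j} \<le> 2 - m i - m j) \<and>
     (\<forall>i\<in>V. \<forall>j\<in>V. \<forall>k\<in>V. D {i, k} \<le> D {i, j} + D {j, k} \<and> D {i, j} + D {j, k} + D {i, k} \<le> 2)"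

lemma cut_metricD:
  assumes "cut_metric V D m" "i \<in> V" "j \<in> V" "k \<in> V"
  shows "0 \<le> m i" "m i \<le> 1" "D {i} = 0"
    "m i - m j \<le> D {i, j}" "D {i, j} \<le> m i + m j" "D {i, j} \<le> 2 - m i - m j"
    "D {i, k} \<le> D {i, j} + D {j, k}" "D {i, j} + D {j, k} + D {i, k} \<le> 2"
  using assms unfolding cut_metric_def by simp_all

text \<open>The semimetric polytope on four points is the cut polytope: \<open>q x y z\<close>
  weighs the cut that labels \<open>v\<close>, \<open>i\<close>, \<open>j\<close> by
  \<open>x\<close>, \<open>y\<close>, \<open>z\<close> and the apex by \<open>False\<close>. Seven
  linear conditions on eight weights leave one free parameter; the sixteen comparisons between its
  lower and upper bounds are rearranged hypotheses.\<close>

lemma cut_metric_four_points: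
  fixes mv mi mj dvi dvj dij :: real
  assumes "0 \<le> mv" "mv \<le> 1" "0 \<le> mi" "mi \<le> 1" "0 \<le> mj" "mj \<le> 1"
    and "\<bar>mv - mi\<bar> \<le> dvi" "dvi \<le> mv + mi" "dvi \<le> 2 - mv - mi"
    and "\<bar>mv - mj\<bar> \<le> dvj" "dvj \<le> mv + mj" "dvj \<le> 2 - mv - mj"
    and "\<bar>mi - mj\<bar> \<le> dij" "dij \<le> mi + mj" "dij \<le> 2 - mi - mj"
    and "dvi \<le> dvj + dij" "dvj \<le> dvi + dij" "dij \<le> dvi + dvj" "dvi + dvj + dij \<le> 2"
  obtains q :: "bool \<Rightarrow> bool \<Rightarrow> bool \<Rightarrow> real" where "\<And>x y z. 0 \<le> q x y z"
    "q False False False + q False False True + q False True False + q False True True +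
     q True False False + q True False True + q True True False + q True True True = 1"
    "mv = q True False False + q True False True + q True True False + q True True True"
    "mi = q False True False + q False True True + q True True False + q True True True"
    "mj = q False False True + q False True True + q True False True + q True True True"
    "dvi = q True False False + q True False True + q False True False + q False True True"
    "dvj = q True False False + q True True False + q False False True + q False True True"
    "dij = q False True False + q True True False + q False False True + q True False True"
proof -
  \<comment> \<open>The probabilities that \<open>v\<close> and \<open>i\<close>, \<open>v\<close>
    and \<open>j\<close>, \<open>i\<close> and \<open>j\<close> are both labelled
    \<open>True\<close>.\<close>
  define a b c where "a = (mv + mi - dvi) / 2" and "b = (mv + mj - dvj) / 2" and "c = (mi + mj - dij) / 2"
  have abc: "2 * a = mv + mi - dvi" "2 * b = mv + mj - dvj" "2 * c = mi + mj - dij"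
    by (simp_all add: a_def b_def c_def)
  have abs: "mv - mi \<le> dvi" "mi - mv \<le> dvi" "mv - mj \<le> dvj" "mj - mv \<le> dvj" "mi - mj \<le> dij" "mj - mi \<le> dij"
    using assms(7,10,13) by linarith+
  have 1: "0 \<le> a" "0 \<le> b" "0 \<le> c" "0 \<le> 1 - mv - mi - mj + a + b + c"
    using abc assms(8,11,14,19) by linarith+
  have 2: "a + b - mv \<le> a" "a + b - mv \<le> b" "a + b - mv \<le> c" "a + b - mv \<le> 1 - mv - mi - mj + a + b + c"
    using abc abs(2,4) assms(15,18) by linarith+
  have 3: "a + c - mi \<le> a" "a + c - mi \<le> b" "a + c - mi \<le> c" "a + c - mi \<le> 1 - mv - mi - mj + a + b + c"
    using abc abs(1,6) assms(12,17) by linarith+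
  have 4: "b + c - mj \<le> a" "b + c - mj \<le> b" "b + c - mj \<le> c" "b + c - mj \<le> 1 - mv - mi - mj + a + b + c"
    using abc abs(3,5) assms(9,16) by linarith+
  \<comment> \<open>\<open>t\<close> becomes \<open>q True True True\<close>; the four lower and
    four upper bounds say that the eight weights are nonnegative.\<close>
  have "\<exists>t. (\<forall>l\<in>{0, a + b - mv, a + c - mi, b + c - mj}. l \<le> t) \<and>
      (\<forall>u\<in>{a, b, c, 1 - mv - mi - mj + a + b + c}. t \<le> u)"
    by (rule separating_number, simp, simp) (use 1 2 3 4 in blast)
  then obtain t where t: "0 \<le> t" "a + b - mv \<le> t" "a + c - mi \<le> t" "b + c - mj \<le> t"
    "t \<le> a" "t \<le> b" "t \<le> c" "t \<le> 1 - mv - mi - mj + a + b + c" by auto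
  define q where "q x y z =
    (if x then if y then if z then t else a - t else if z then b - t else mv - a - b + t
     else if y then if z then c - t else mi - a - c + t
       else if z then mj - b - c + t else 1 - mv - mi - mj + a + b + c - t)" for x y z
  show thesis
  proof (rule that[of q])
    show "0 \<le> q x y z" for x y z
      using t unfolding q_def by (cases x; cases y; cases z; simp)
  qed (use abc in \<open>simp_all add: q_def\<close>)
qed

text \<open>Minimizing out the label of \<open>v\<close> leaves a function of two binary labels; its
  four values determine the four coefficients. For the second claim, \<open>D\<close> and
  \<open>m\<close> on the four points are a mixture of cuts, and in each cut the minimum is at most
  the local energy.\<close>

lemma eliminate_vertex:
  fixes \<theta>i \<theta>j \<theta>v :: real
  assumes cm: "cut_metric V D m" and V: "v \<in> V" "i \<in> V" "j \<in> V"
  obtains \<alpha> \<beta>i \<beta>j \<eta> :: real where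
    "\<And>t r. t \<in> {0, 1} \<Longrightarrow> r \<in> {0, 1} \<Longrightarrow> \<exists>s\<in>{0, 1 :: nat}.
       \<theta>i * of_bool (s \<noteq> t) + \<theta>j * of_bool (s \<noteq> r) + \<theta>v * of_bool (s \<noteq> 0) =
       \<alpha> + \<beta>i * of_bool (t \<noteq> 0) + \<beta>j * of_bool (r \<noteq> 0) + \<eta> * of_bool (t \<noteq> r)"
    "\<alpha> + \<beta>i * m i + \<beta>j * m j + \<eta> * D {i, j} \<le> \<theta>i * D {v, i} + \<theta>j * D {v, j} + \<theta>v * m v"
proof -
  define f where "f s t r = \<theta>i * of_bool (s \<noteq> t) + \<theta>j * of_bool (s \<noteq> r) + \<theta>v * of_bool s" for s t r
  define M where "M t r = min (f False t r) (f True t r)" for t r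
  define \<alpha> where "\<alpha> = M False False"
  define \<eta> where "\<eta> = (M True False + M False True - M True True - M False False) / 2"
  define \<beta>i where "\<beta>i = (M True False + M True True - M False True - M False False) / 2"
  define \<beta>j where "\<beta>j = (M False True + M True True - M True False - M False False) / 2"
  note defs = \<alpha>_def \<eta>_def \<beta>i_def \<beta>j_def
  have M: "M t r = \<alpha> + \<beta>i * of_bool t + \<beta>j * of_bool r + \<eta> * of_bool (t \<noteq> r)" for t r
    by (cases t; cases r) (simp_all add: defs field_simps)
  have comm: "D {i, v} = D {v, i}" "D {j, v} = D {v, j}" "D {j, i} = D {i, j}"
    by (simp_all add: insert_commute)
  note D = cut_metricD[OF cm]
  note Dvi = D[OF V(1,2,3)] and Diw = D[OF V(2,1,3)] and Dvj = D[OF V(1,3,2)] and Djv = D[OF V(3,1,2)]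
    and Dij = D[OF V(2,3,1)] and Dji = D[OF V(3,2,1)]
  have tri: "D {i, j} \<le> D {v, i} + D {v, j}" "D {v, i} \<le> D {v, j} + D {i, j}" "D {v, j} \<le> D {v, i} + D {i, j}"
    "D {v, i} + D {v, j} + D {i, j} \<le> 2"
    using Diw(7) Dvj(7) Dvi(7) Dvi(8) unfolding comm by linarith+
  have bnd: "0 \<le> m v" "m v \<le> 1" "0 \<le> m i" "m i \<le> 1" "0 \<le> m j" "m j \<le> 1"
    "\<bar>m v - m i\<bar> \<le> D {v, i}" "D {v, i} \<le> m v + m i" "D {v, i} \<le> 2 - m v - m i"
    "\<bar>m v - m j\<bar> \<le> D {v, j}" "D {v, j} \<le> m v + m j" "D {v, j} \<le> 2 - m v - m j"
    "\<bar>m i - m j\<bar> \<le> D {i, j}" "D {i, j} \<le> m i + m j" "D {i, j} \<le> 2 - m i - m j"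
    using Dvi(1,2,4-6) Dij(1,2,4-6) Djv(1,2) Diw(4) Dvj(4-6) Djv(4) Dji(4) unfolding comm abs_le_iff
    by simp_all
  obtain q where q: "\<And>x y z. 0 \<le> q x y z"
    "q False False False + q False False True + q False True False + q False True True +
     q True False False + q True False True + q True True False + q True True True = 1"
    "m v = q True False False + q True False True + q True True False + q True True True"
    "m i = q False True False + q False True True + q True True False + q True True True"
    "m j = q False False True + q False True True + q True False True + q True True True"
    "D {v, i} = q True False False + q True False True + q False True False + q False True True"
    "D {v, j} = q True False False + q True True False + q False False True + q False True True"
    "D {i, j} = q False True False + q True True False + q False False True + q True False True"
    by (rule cut_metric_four_points[OF bnd tri(2,3,1,4)]) (rule that; assumption)
  have nonneg: "0 \<le> q s t r * (f s t r - M t r)" for s t r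
    using q(1)[of s t r] by (intro mult_nonneg_nonneg) (cases s; simp add: M_def)+
  have "\<alpha> = \<alpha> * (q False False False + q False False True + q False True False + q False True True +
     q True False False + q True False True + q True True False + q True True True)"
    unfolding q(2) by simp
  \<comment> \<open>The difference of the two sides is the expected excess, under \<open>q\<close>,
    of the local energy over its minimum.\<close>
  then have "\<theta>i * D {v, i} + \<theta>j * D {v, j} + \<theta>v * m v - (\<alpha> + \<beta>i * m i + \<beta>j * m j + \<eta> * D {i, j}) =
    q False False False * (f False False False - M False False) +
    q False False True * (f False False True - M False True) +
    q False True False * (f False True False - M True False) +
    q False True True * (f False True True - M True True) +
    q True False False * (f True False False - M False False) +
    q True False True * (f True False True - M False True) +
    q True True False * (f True True False - M True False) +
    q True True True * (f True True True - M True True)"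
    unfolding q(3-) M f_def by (simp add: algebra_simps)
  also have "\<dots> \<ge> 0" by (intro add_nonneg_nonneg nonneg)
  finally have le: "\<alpha> + \<beta>i * m i + \<beta>j * m j + \<eta> * D {i, j} \<le> \<theta>i * D {v, i} + \<theta>j * D {v, j} + \<theta>v * m v"
    by simp
  show thesis
  proof (rule that[OF _ le])
    fix t r :: nat assume tr: "t \<in> {0, 1}" "r \<in> {0, 1}"
    have "\<exists>s. f s (t \<noteq> 0) (r \<noteq> 0) = M (t \<noteq> 0) (r \<noteq> 0)"
      unfolding M_def min_def by metis
    then obtain s where s: "f s (t \<noteq> 0) (r \<noteq> 0) = M (t \<noteq> 0) (r \<noteq> 0)" by blast
    show "\<exists>s\<in>{0, 1 :: nat}.
       \<theta>i * of_bool (s \<noteq> t) + \<theta>j * of_bool (s \<noteq> r) + \<theta>v * of_bool (s \<noteq> 0) =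
       \<alpha> + \<beta>i * of_bool (t \<noteq> 0) + \<beta>j * of_bool (r \<noteq> 0) + \<eta> * of_bool (t \<noteq> r)"
      by (rule bexI[of _ "of_bool s"], use s tr in \<open>cases s; auto simp: f_def M\<close>, simp)
  qed
qed

lemma sum_edges_at_vertex:
  fixes g :: "'v set \<Rightarrow> real"
  assumes sg: "simple_graph W F" and fin: "finite F" and N: "neighbours F v \<subseteq> {i, j}"
  shows "sum g F = sum g {e \<in> F. v \<notin> e} + (if {v, i} \<in> F then g {v, i} else 0) +
    (if i \<noteq> j \<and> {v, j} \<in> F then g {v, j} else 0)"
proof -
  have eq: "{e \<in> F. v \<in> e} = (\<lambda>u. {v, u}) ` neighbours F v"
  proof
    show "{e \<in> F. v \<in> e} \<subseteq> (\<lambda>u. {v, u}) ` neighbours F v"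
    proof
      fix e assume e: "e \<in> {e \<in> F. v \<in> e}"
      then have "card e = 2" using sg by (auto simp: simple_graph_def)
      then obtain u where "e = {v, u}" using e by (auto simp: card_2_iff)
      then show "e \<in> (\<lambda>u. {v, u}) ` neighbours F v" using e by (auto simp: neighbours_def)
    qed
  qed (auto simp: neighbours_def)
  have "inj_on (\<lambda>u. {v, u}) (neighbours F v)"
    by (auto simp: inj_on_def doubleton_eq_iff)
  then have "sum g {e \<in> F. v \<in> e} = (\<Sum>u\<in>neighbours F v. g {v, u})"
    unfolding eq by (simp add: sum.reindex)
  also have "\<dots> = (\<Sum>u\<in>{i, j}. if {v, u} \<in> F then g {v, u} else 0)"
    using N by (intro sum.mono_neutral_cong_left) (auto simp: neighbours_def)
  also have "\<dots> = (if {v, i} \<in> F then g {v, i} else 0) + (if i \<noteq> j \<and> {v, j} \<in> F then g {v, j} else 0)"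
    by (cases "i = j") auto
  finally have "sum g {e \<in> F. v \<in> e} = (if {v, i} \<in> F then g {v, i} else 0) +
    (if i \<noteq> j \<and> {v, j} \<in> F then g {v, j} else 0)" .
  moreover have "sum g F = sum g ({e \<in> F. v \<notin> e} \<union> {e \<in> F. v \<in> e})"
    by (rule arg_cong[of _ _ "sum g"]) auto
  moreover have "\<dots> = sum g {e \<in> F. v \<notin> e} + sum g {e \<in> F. v \<in> e}"
    using fin by (intro sum.union_disjoint) auto
  ultimately show ?thesis by simp
qed

text \<open>Degree at most one is encoded as \<open>i = j\<close>, with an arbitrary other vertex if
  there is no neighbour, so that one elimination step covers all cases.\<close>

lemma two_neighbours:
  assumes sg: "simple_graph W F" and W: "finite W" "W \<noteq> {v}" "v \<in> W"
    and deg: "card (neighbours F v) \<le> 2"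
  obtains i j where "i \<in> W - {v}" "j \<in> W - {v}" "neighbours F v \<subseteq> {i, j}"
    "i \<noteq> j \<Longrightarrow> {v, i} \<in> F \<and> {v, j} \<in> F"
proof -
  have N: "neighbours F v \<subseteq> W - {v}" by (rule neighbours_subset[OF sg])
  then have fin: "finite (neighbours F v)" using W finite_subset by blast
  consider "card (neighbours F v) = 0" | "card (neighbours F v) = 1" | "card (neighbours F v) = 2"
    using deg by linarith
  then show thesis
  proof cases
    case 1
    then show thesis using fin W that by auto
  next
    case 2
    then obtain i where "neighbours F v = {i}" by (auto simp: card_1_singleton_iff)
    then show thesis using N that[of i i] by auto
  next
    case 3
    then obtain i j where "neighbours F v = {i, j}" by (auto simp: card_2_iff)
    moreover then have "{v, i} \<in> F \<and> {v, j} \<in> F" by (auto simp: neighbours_def)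
    ultimately show thesis using N that[of i j] by auto
  qed
qed

lemma outer_drawn_eliminate:
  assumes "outer_drawn W F \<phi> \<gamma> U" and "i \<noteq> j \<Longrightarrow> {v, i} \<in> F \<and> {v, j} \<in> F"
  obtains \<gamma>' where "outer_drawn (W - {v}) (if i = j then {e \<in> F. v \<notin> e} else insert {i, j} {e \<in> F. v \<notin> e}) \<phi> \<gamma>' U"
proof (cases "i = j")
  case True
  then show thesis by (intro that[of \<gamma>]) (simp add: outer_drawn_delete[OF assms(1)])
next
  case False
  then have "{i, v} \<in> F" "{v, j} \<in> F" using assms(2) by (auto simp: insert_commute)
  then obtain \<gamma>' where "outer_drawn (W - {v}) (insert {i, j} {e \<in> F. v \<notin> e}) \<phi> \<gamma>' U"
    using outer_drawn_suppress[OF assms(1) False] by blast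
  then show thesis using False by (intro that[of \<gamma>']) simp
qed

text \<open>Removing \<open>v\<close> replaces its local energy by the terms from
  \<open>eliminate_vertex\<close>, which are added to the parameters of the remaining graph.
  Extending the labeling optimally to \<open>v\<close> raises the energy by exactly
  \<open>\<alpha>\<close> and the right-hand side by at least \<open>\<alpha>\<close>.
  \<open>D\<close> and \<open>m\<close> stay fixed, while drawing and parameters vary in the
  induction.\<close>

lemma outer_drawn_energy_bound:
  fixes W V :: "'v set"
  assumes "finite W" "outer_drawn W F \<phi> \<gamma> U" "W \<subseteq> V" "cut_metric V D m"
  shows "\<exists>X\<in>labelings W. energy W F \<theta>E \<theta>V X \<le> (\<Sum>e\<in>F. \<theta>E e * D e) + (\<Sum>i\<in>W. \<theta>V i * m i)"
  using assms
proof (induction "card W" arbitrary: W F \<gamma> \<theta>E \<theta>V)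
  case 0
  then have "W = {}" by simp
  moreover then have "F = {}" using 0(3) by (force simp: outer_drawn_def simple_graph_def)
  ultimately show ?case by (simp add: energy_def pairwise_energy_def labelings_def)
next
  case (Suc n)
  note fin = Suc.prems(1) and od = Suc.prems(2) and WV = Suc.prems(3) and cm = Suc.prems(4)
  have sg: "simple_graph W F" using od by (simp add: outer_drawn_def)
  have finF: "finite F"
    by (rule finite_subset[of _ "Pow W"]) (use sg fin in \<open>auto simp: simple_graph_def\<close>)
  have "W \<noteq> {}" using Suc.hyps(2) by auto
  then obtain v where v: "v \<in> W" "card (neighbours F v) \<le> 2"
    using outer_drawn_degree_le_2[OF od fin] by blast
  have vV: "v \<in> V" using v WV by blast
  show ?case
  proof (cases "W = {v}")
    case True
    have "F = {}"
    proof (rule ccontr)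
      assume "F \<noteq> {}"
      then obtain e where "e \<subseteq> {v}" "card e = 2" using sg True by (auto simp: simple_graph_def)
      then show False using card_mono[of "{v}" e] by simp
    qed
    have m: "0 \<le> m v" "m v \<le> 1" using cm vV by (auto simp: cut_metric_def)
    \<comment> \<open>The bound is linear in \<open>m v\<close>, so one of the end points 0 and 1
      does at least as well.\<close>
    define s :: nat where "s = of_bool (\<theta>V v < 0)"
    have "\<theta>V v * of_bool (s \<noteq> 0) \<le> \<theta>V v * m v"
      using m mult_left_mono_neg[of "m v" 1 "\<theta>V v"] by (auto simp: s_def)
    moreover have "(\<lambda>u\<in>W. s) \<in> labelings W" by (auto simp: labelings_def s_def)
    ultimately show ?thesis
      using True \<open>F = {}\<close> by (intro bexI[of _ "\<lambda>u\<in>W. s"]) (auto simp: energy_def pairwise_energy_def)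
  next
    case False
    obtain i j where ij: "i \<in> W - {v}" "j \<in> W - {v}" "neighbours F v \<subseteq> {i, j}"
      "i \<noteq> j \<Longrightarrow> {v, i} \<in> F \<and> {v, j} \<in> F"
      using two_neighbours[OF sg fin False v] by metis
    define F0 where "F0 = {e \<in> F. v \<notin> e}"
    define F' where "F' = (if i = j then F0 else insert {i, j} F0)"
    obtain \<gamma>' where od': "outer_drawn (W - {v}) F' \<phi> \<gamma>' U"
      using outer_drawn_eliminate[OF od ij(4)] unfolding F'_def F0_def by blast
    define \<theta>i where "\<theta>i = (if {v, i} \<in> F then \<theta>E {v, i} else 0)"
    define \<theta>j where "\<theta>j = (if i \<noteq> j \<and> {v, j} \<in> F then \<theta>E {v, j} else 0)"
    obtain \<alpha> \<beta>i \<beta>j \<eta> where red: "\<And>t r. t \<in> {0, 1} \<Longrightarrow> r \<in> {0, 1} \<Longrightarrow> \<exists>s\<in>{0, 1 :: nat}.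
         \<theta>i * of_bool (s \<noteq> t) + \<theta>j * of_bool (s \<noteq> r) + \<theta>V v * of_bool (s \<noteq> 0) =
         \<alpha> + \<beta>i * of_bool (t \<noteq> 0) + \<beta>j * of_bool (r \<noteq> 0) + \<eta> * of_bool (t \<noteq> r)"
      and le: "\<alpha> + \<beta>i * m i + \<beta>j * m j + \<eta> * D {i, j} \<le> \<theta>i * D {v, i} + \<theta>j * D {v, j} + \<theta>V v * m v"
      using eliminate_vertex[OF cm vV, of i j \<theta>i \<theta>j "\<theta>V v"] ij WV by blast
    \<comment> \<open>If \<open>{i, j}\<close> is already an edge, \<open>\<eta>\<close> is added to
      its weight; a newly created edge has weight \<open>\<eta>\<close>.\<close>
    define \<theta>E' where "\<theta>E' e = (if e \<in> F then \<theta>E e else 0) + (if e = {i, j} then \<eta> else 0)" for e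
    define \<theta>V' where "\<theta>V' u = \<theta>V u + (if u = i then \<beta>i else 0) + (if u = j then \<beta>j else 0)" for u
    have finF0: "finite F0" using finF by (simp add: F0_def)
    have sum_F: "(\<Sum>e\<in>F. \<theta>E e * h e) = (\<Sum>e\<in>F0. \<theta>E e * h e) + \<theta>i * h {v, i} + \<theta>j * h {v, j}" for h
      using sum_edges_at_vertex[OF sg finF ij(3), of "\<lambda>e. \<theta>E e * h e"]
      by (auto simp: F0_def \<theta>i_def \<theta>j_def)
    \<comment> \<open>For \<open>i = j\<close> no edge is added, and the \<open>\<eta>\<close> term
      vanishes because \<open>h {i} = 0\<close>.\<close>
    have sum_F': "(\<Sum>e\<in>F'. \<theta>E' e * h e) = (\<Sum>e\<in>F0. \<theta>E e * h e) + \<eta> * h {i, j}"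
      if h: "i = j \<Longrightarrow> h {i} = 0" for h
    proof -
      have "(\<Sum>e\<in>F'. \<theta>E' e * h e) =
        (\<Sum>e\<in>F'. if e \<in> F then \<theta>E e * h e else 0) + (\<Sum>e\<in>F'. if e = {i, j} then \<eta> * h e else 0)"
        unfolding sum.distrib[symmetric] by (rule sum.cong) (auto simp: \<theta>E'_def algebra_simps)
      also have "(\<Sum>e\<in>F'. if e \<in> F then \<theta>E e * h e else 0) = (\<Sum>e\<in>F0. \<theta>E e * h e)"
        using finF0 ij by (intro sum.mono_neutral_cong_right) (auto simp: F'_def F0_def)
      also have "(\<Sum>e\<in>F'. if e = {i, j} then \<eta> * h e else 0) = \<eta> * h {i, j}"
        using finF0 h by (cases "i = j") (auto simp: F'_def)
      finally show ?thesis .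
    qed
    have sum_W: "(\<Sum>u\<in>W. \<theta>V u * h u) = (\<Sum>u\<in>W - {v}. \<theta>V u * h u) + \<theta>V v * h v" for h
      using fin v by (simp add: sum.remove)
    have sum_W': "(\<Sum>u\<in>W - {v}. \<theta>V' u * h u) = (\<Sum>u\<in>W - {v}. \<theta>V u * h u) + \<beta>i * h i + \<beta>j * h j" for h
    proof -
      have "(\<Sum>u\<in>W - {v}. \<theta>V' u * h u) = (\<Sum>u\<in>W - {v}. \<theta>V u * h u +
          (if u = i then \<beta>i * h u else 0) + (if u = j then \<beta>j * h u else 0))"
        by (rule sum.cong) (auto simp: \<theta>V'_def algebra_simps)
      then show ?thesis using fin ij by (simp add: sum.distrib)
    qed
    have "n = card (W - {v})" using Suc.hyps(2) v fin by simp
    then obtain X' where X': "X' \<in> labelings (W - {v})"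
      "energy (W - {v}) F' \<theta>E' \<theta>V' X' \<le> (\<Sum>e\<in>F'. \<theta>E' e * D e) + (\<Sum>u\<in>W - {v}. \<theta>V' u * m u)"
      using Suc.hyps(1)[OF _ _ od' _ cm, of \<theta>E' \<theta>V'] fin WV by auto
    have X'01: "X' u \<in> {0, 1}" if "u \<in> W - {v}" for u
      using X'(1) that unfolding labelings_def by blast
    obtain s :: nat where s: "s \<in> {0, 1}"
      "\<theta>i * of_bool (s \<noteq> X' i) + \<theta>j * of_bool (s \<noteq> X' j) + \<theta>V v * of_bool (s \<noteq> 0) =
         \<alpha> + \<beta>i * of_bool (X' i \<noteq> 0) + \<beta>j * of_bool (X' j \<noteq> 0) + \<eta> * of_bool (X' i \<noteq> X' j)"
      using red[OF X'01[OF ij(1)] X'01[OF ij(2)]] by blast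
    define X where "X = X'(v := s)"
    define cut :: "('v \<Rightarrow> nat) \<Rightarrow> 'v set \<Rightarrow> real" where "cut Y e = of_bool (\<exists>i\<in>e. \<exists>j\<in>e. Y i \<noteq> Y j)" for Y e
    have en: "energy W F \<theta>E \<theta>V Y = (\<Sum>e\<in>F. \<theta>E e * cut Y e) + (\<Sum>u\<in>W. \<theta>V u * of_bool (Y u \<noteq> 0))"
      for W F \<theta>E \<theta>V Y by (simp add: energy_def pairwise_energy_def cut_def)
    have cut0: "(\<Sum>e\<in>F0. \<theta>E e * cut X e) = (\<Sum>e\<in>F0. \<theta>E e * cut X' e)"
    proof (rule sum.cong[OF refl])
      fix e assume "e \<in> F0"
      then have "X u = X' u" if "u \<in> e" for u using that by (auto simp: F0_def X_def)
      then show "\<theta>E e * cut X e = \<theta>E e * cut X' e" by (simp add: cut_def)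
    qed
    have cutv: "cut X {v, i} = of_bool (s \<noteq> X' i)" "cut X {v, j} = of_bool (s \<noteq> X' j)"
      "cut X' {i, j} = of_bool (X' i \<noteq> X' j)" "cut X' {i} = 0"
      using ij by (auto simp: cut_def X_def)
    have W0: "(\<Sum>u\<in>W - {v}. \<theta>V u * of_bool (X u \<noteq> 0)) = (\<Sum>u\<in>W - {v}. \<theta>V u * of_bool (X' u \<noteq> 0))"
      by (rule sum.cong) (auto simp: X_def)
    have "energy W F \<theta>E \<theta>V X = energy (W - {v}) F' \<theta>E' \<theta>V' X' + \<alpha>"
      unfolding en sum_F[of "cut X"] sum_W[of "\<lambda>u. of_bool (X u \<noteq> 0)"] sum_F'[of "cut X'", OF cutv(4)]
        sum_W'[of "\<lambda>u. of_bool (X' u \<noteq> 0)"] cut0 W0 cutv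
      using s(2) by (simp add: X_def)
    also have "\<dots> \<le> (\<Sum>e\<in>F. \<theta>E e * D e) + (\<Sum>u\<in>W. \<theta>V u * m u)"
    proof -
      have "D {i} = 0" using cm ij WV by (auto simp: cut_metric_def)
      from X'(2)[unfolded sum_F'[of D, OF this] sum_W'[of m]] le
      show ?thesis unfolding sum_F[of D] sum_W[of m] by linarith
    qed
    finally have "energy W F \<theta>E \<theta>V X \<le> (\<Sum>e\<in>F. \<theta>E e * D e) + (\<Sum>u\<in>W. \<theta>V u * m u)" .
    moreover have "X \<in> labelings W"
      using X'(1) s(1) v(1) unfolding X_def labelings_def by (auto simp: PiE_iff extensional_def)
    ultimately show ?thesis by blast
  qed
qed

lemma min_energy_le:
  assumes "finite W" "X \<in> labelings W"
  shows "min_energy W F \<theta>E \<theta>V \<le> energy W F \<theta>E \<theta>V X"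
  unfolding min_energy_def using assms
  by (intro Min_le finite_imageI imageI) (auto simp: labelings_def intro: finite_PiE)

text \<open>Values between \<open>\<bar>m i - m j\<bar>\<close> and \<open>min (m i + m j) (2 - m i - m j)\<close> are exactly those compatible
  with the apex; clamping a metric \<open>d\<close> to this range preserves the inequalities among its own triangles.\<close>

definition apex_clamp :: "('v \<Rightarrow> real) \<Rightarrow> ('v \<Rightarrow> 'v \<Rightarrow> real) \<Rightarrow> 'v \<Rightarrow> 'v \<Rightarrow> real" where
  "apex_clamp m d i j = max \<bar>m i - m j\<bar> (min (d i j) (min (m i + m j) (2 - m i - m j)))"

text \<open>Passes to unordered pairs; the description is unique as soon as \<open>d\<close> is
  symmetric.\<close>

definition apex_clamp_edge :: "('v \<Rightarrow> real) \<Rightarrow> ('v \<Rightarrow> 'v \<Rightarrow> real) \<Rightarrow> 'v set \<Rightarrow> real" where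
  "apex_clamp_edge m d e = (THE r. \<exists>i j. e = {i, j} \<and> r = apex_clamp m d i j)"

text \<open>The last two claims drive the case analysis below: clamping exceeds \<open>d i j\<close>
  only at the lower end of the admissible range and falls short of it only at the upper end.\<close>

lemma apex_clamp_props:
  assumes "0 \<le> m i" "m i \<le> 1" "0 \<le> m j" "m j \<le> 1"
  shows "m i - m j \<le> apex_clamp m d i j" "m j - m i \<le> apex_clamp m d i j"
    "apex_clamp m d i j \<le> m i + m j" "apex_clamp m d i j \<le> 2 - m i - m j"
    "apex_clamp m d i j = m i - m j \<or> apex_clamp m d i j = m j - m i \<or> apex_clamp m d i j \<le> d i j"
    "d i j \<le> apex_clamp m d i j \<or> apex_clamp m d i j = m i + m j \<or> apex_clamp m d i j = 2 - m i - m j"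
  using assms unfolding apex_clamp_def max_def min_def abs_if by (simp_all split: if_splits)

lemma apex_clamp_edge_eq:
  assumes "\<And>i j. d i j = d j i"
  shows "apex_clamp_edge m d {i, j} = apex_clamp m d i j"
proof -
  have "apex_clamp m d i j = apex_clamp m d j i" for i j
    using assms[of i j] by (simp add: apex_clamp_def abs_minus_commute algebra_simps)
  then show ?thesis
    unfolding apex_clamp_edge_def by (intro the_equality) (auto simp: doubleton_eq_iff)
qed

text \<open>In each triangle either no side is clamped in the harmful direction, and the inequality
  is inherited from \<open>d\<close>, or some side sits at a bound given by \<open>m\<close>, and
  the apex inequalities for the other sides suffice.\<close>

lemma cut_metric_apex_clamp:
  assumes sym: "\<And>i j. d i j = d j i" and d0: "\<And>i. d i i = 0"
    and m: "\<And>i. i \<in> V \<Longrightarrow> 0 \<le> m i" "\<And>i. i \<in> V \<Longrightarrow> m i \<le> 1"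
    and tri: "\<And>i j k. i \<in> V \<Longrightarrow> j \<in> V \<Longrightarrow> k \<in> V \<Longrightarrow> d i k \<le> d i j + d j k"
      "\<And>i j k. i \<in> V \<Longrightarrow> j \<in> V \<Longrightarrow> k \<in> V \<Longrightarrow> d i j + d j k + d i k \<le> 2"
  shows "cut_metric V (apex_clamp_edge m d) m"
proof -
  have D: "apex_clamp_edge m d {i, j} = apex_clamp m d i j" for i j by (rule apex_clamp_edge_eq[OF sym])
  have D1: "apex_clamp_edge m d {i} = apex_clamp m d i i" for i using D[of i i] by simp
  have 1: "apex_clamp m d i i = 0" if "i \<in> V" for i
    using m[OF that] d0[of i] by (simp add: apex_clamp_def)
  have cp: "m i - m j \<le> apex_clamp m d i j" "m j - m i \<le> apex_clamp m d i j"
    "apex_clamp m d i j \<le> m i + m j" "apex_clamp m d i j \<le> 2 - m i - m j"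
    "apex_clamp m d i j = m i - m j \<or> apex_clamp m d i j = m j - m i \<or> apex_clamp m d i j \<le> d i j"
    "d i j \<le> apex_clamp m d i j \<or> apex_clamp m d i j = m i + m j \<or> apex_clamp m d i j = 2 - m i - m j"
    if "i \<in> V" "j \<in> V" for i j
    by (rule apex_clamp_props[where m = m and d = d, OF m(1)[OF that(1)] m(2)[OF that(1)] m(1)[OF that(2)] m(2)[OF that(2)]])+
  have 3: "apex_clamp m d i k \<le> apex_clamp m d i j + apex_clamp m d j k" if V: "i \<in> V" "j \<in> V" "k \<in> V" for i j k
  proof -
    note ik = cp[OF V(1,3)] and ij = cp[OF V(1,2)] and jk = cp[OF V(2,3)]
    from ik(5) consider "apex_clamp m d i k = m i - m k" | "apex_clamp m d i k = m k - m i"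
      | "apex_clamp m d i k \<le> d i k" by blast
    then show ?thesis
    proof cases
      case 3
      from ij(6) jk(6) consider "d i j \<le> apex_clamp m d i j" "d j k \<le> apex_clamp m d j k"
        | "apex_clamp m d i j = m i + m j" | "apex_clamp m d i j = 2 - m i - m j"
        | "apex_clamp m d j k = m j + m k" | "apex_clamp m d j k = 2 - m j - m k" by blast
      then show ?thesis using 3 tri(1)[OF V] ik(1-4) ij(1-4) jk(1-4) by cases linarith+
    qed (use ij(1,2) jk(1,2) in linarith)+
  qed
  have 4: "apex_clamp m d i j + apex_clamp m d j k + apex_clamp m d i k \<le> 2"
    if V: "i \<in> V" "j \<in> V" "k \<in> V" for i j k
  proof -
    note ik = cp[OF V(1,3)] and ij = cp[OF V(1,2)] and jk = cp[OF V(2,3)]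
    from ik(5) ij(5) jk(5) consider "apex_clamp m d i k \<le> d i k" "apex_clamp m d i j \<le> d i j" "apex_clamp m d j k \<le> d j k"
      | "apex_clamp m d i k = m i - m k" | "apex_clamp m d i k = m k - m i"
      | "apex_clamp m d i j = m i - m j" | "apex_clamp m d i j = m j - m i"
      | "apex_clamp m d j k = m j - m k" | "apex_clamp m d j k = m k - m j" by blast
    then show ?thesis using tri(2)[OF V] ik(3,4) ij(3,4) jk(3,4) by cases linarith+
  qed
  show ?thesis unfolding cut_metric_def D D1 using 1 cp(1,3,4) 3 4 m by blast
qed

subsection \<open>The planar cycle covering bound\<close>

lemma finite_labelings: "finite A \<Longrightarrow> finite (labelings A)"
  by (simp add: labelings_def finite_PiE)

lemma labelings_01: "X \<in> labelings A \<Longrightarrow> i \<in> A \<Longrightarrow> X i = 0 \<or> X i = 1"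
  unfolding labelings_def by (auto dest: PiE_mem)

locale pcc =
  fixes V :: "'v set" and E :: "'v set set"
    and \<phi> :: "'v \<Rightarrow> complex" and \<gamma> :: "'v set \<Rightarrow> real \<Rightarrow> complex"
    and \<theta>E :: "'v set \<Rightarrow> real" and \<theta>V :: "'v \<Rightarrow> real"
  assumes fin: "finite V" and sg: "simple_graph V E" and pe: "planar_embedding V E \<phi> \<gamma>"
begin

abbreviation "\<F> \<equiv> faces V E \<phi> \<gamma>"
abbreviation "N \<equiv> incident_faces V E \<phi> \<gamma>"
abbreviation "feasible \<equiv> pcc_feasible V E \<phi> \<gamma> \<theta>V"
abbreviation "min_pcc \<equiv> pcc_min_energy V E \<phi> \<gamma> \<theta>E"

definition S :: "(('v \<Rightarrow> nat) \<times> (complex set \<Rightarrow> nat)) set" where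
  "S = labelings V \<times> labelings \<F>"

definition base :: "'v \<Rightarrow> complex set" where
  "base i = (SOME f. f \<in> N i)"

definition diff :: "'v \<Rightarrow> complex set \<Rightarrow> ('v \<Rightarrow> nat) \<times> (complex set \<Rightarrow> nat) \<Rightarrow> real" where
  "diff i f s = of_bool (fst s i \<noteq> snd s f)"

text \<open>The dual constraints: feasibility fixes only the sum of the weights
  \<open>\<theta>F i f\<close> over the faces, and its dual counterpart is one common mismatch
  probability for all faces at \<open>i\<close>.\<close>

definition consistent where
  "consistent w \<longleftrightarrow> prob_weights S w \<and>
     (\<forall>i\<in>V. \<forall>f\<in>N i. expect S w (diff i f) = expect S w (diff i (base i)))"

definition cost where
  "cost w = expect S w (\<lambda>s. pairwise_energy E \<theta>E (fst s)) + (\<Sum>i\<in>V. \<theta>V i * expect S w (diff i (base i)))"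

lemma finite_sets: "finite E" "finite \<F>" "finite (N i)" "finite S"
  using finite_edges[OF fin sg] finite_faces[OF fin sg pe] fin
  by (auto simp: incident_faces_def S_def finite_labelings)

lemma base_in: "i \<in> V \<Longrightarrow> base i \<in> N i"
  unfolding base_def some_in_eq by (rule vertex_on_face[OF fin sg pe])

lemma pcc_energy_alt:
  "pcc_energy V E \<phi> \<gamma> \<theta>E \<theta>F (fst s) (snd s) =
    pairwise_energy E \<theta>E (fst s) + (\<Sum>i\<in>V. \<Sum>f\<in>N i. \<theta>F i f * diff i f s)"
  by (simp add: pcc_energy_def diff_def)

lemma min_pcc_le: "s \<in> S \<Longrightarrow> min_pcc \<theta>F \<le> pcc_energy V E \<phi> \<gamma> \<theta>E \<theta>F (fst s) (snd s)"
  unfolding pcc_min_energy_def using finite_sets(4)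
  by (intro Min_le) (auto simp: S_def case_prod_unfold)

lemma le_min_pcc:
  assumes "\<And>s. s \<in> S \<Longrightarrow> z \<le> pcc_energy V E \<phi> \<gamma> \<theta>E \<theta>F (fst s) (snd s)"
  shows "z \<le> min_pcc \<theta>F"
proof -
  have "S \<noteq> {}" by (auto simp: S_def labelings_def PiE_eq_empty_iff)
  then show ?thesis
    unfolding pcc_min_energy_def using finite_sets(4) assms
    by (intro Min.boundedI) (auto simp: S_def case_prod_unfold)
qed

text \<open>Weak duality: under \<open>w\<close> all weights at \<open>i\<close> multiply the same
  probability, so only their sum \<open>\<theta>V i\<close> matters.\<close>

lemma min_pcc_le_cost:
  assumes "feasible \<theta>F" "consistent w"
  shows "min_pcc \<theta>F \<le> cost w"
proof -
  have pw: "prob_weights S w" using assms(2) by (simp add: consistent_def)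
  have "min_pcc \<theta>F \<le> expect S w (\<lambda>s. pcc_energy V E \<phi> \<gamma> \<theta>E \<theta>F (fst s) (snd s))"
    using expect_mono[OF pw min_pcc_le[of _ \<theta>F]] by (simp add: expect_const[OF pw])
  also have "\<dots> = expect S w (\<lambda>s. pairwise_energy E \<theta>E (fst s)) +
      (\<Sum>i\<in>V. \<Sum>f\<in>N i. \<theta>F i f * expect S w (diff i f))"
    unfolding pcc_energy_alt expect_add expect_sum expect_cmult ..
  also have "(\<Sum>i\<in>V. \<Sum>f\<in>N i. \<theta>F i f * expect S w (diff i f)) =
      (\<Sum>i\<in>V. (\<Sum>f\<in>N i. \<theta>F i f) * expect S w (diff i (base i)))"
    using assms(2) by (simp add: consistent_def sum_distrib_right)
  also have "\<dots> = (\<Sum>i\<in>V. \<theta>V i * expect S w (diff i (base i)))"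
    using assms(1) by (simp add: pcc_feasible_def)
  finally show ?thesis by (simp add: cost_def)
qed

text \<open>Strong duality: the multipliers of the consistency constraints become the face
  weights.\<close>

lemma pcc_duality:
  assumes z: "\<And>w. consistent w \<Longrightarrow> z \<le> cost w"
  obtains \<theta>F where "feasible \<theta>F" "z \<le> min_pcc \<theta>F"
proof -
  define c where "c s = pairwise_energy E \<theta>E (fst s) + (\<Sum>i\<in>V. \<theta>V i * diff i (base i) s)" for s
  define g where "g p s = diff (fst p) (snd p) s - diff (fst p) (base (fst p)) s" for p s
  have "\<exists>l. \<forall>s\<in>S. z \<le> c s + (\<Sum>p\<in>Sigma V N. l p * g p s)"
  proof (rule lp_duality)
    show "finite S" "finite (Sigma V N)" using finite_sets fin by auto
    fix w assume w: "prob_weights S w" "\<forall>p\<in>Sigma V N. expect S w (g p) = 0"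
    have "expect S w (diff i f) = expect S w (diff i (base i))" if "i \<in> V" "f \<in> N i" for i f
      using w(2) that unfolding g_def expect_diff by fastforce
    then have "consistent w" using w(1) by (simp add: consistent_def)
    moreover have "expect S w c = cost w"
      unfolding c_def cost_def expect_add expect_sum expect_cmult ..
    ultimately show "z \<le> expect S w c" using z by simp
  qed
  then obtain l where l: "\<And>s. s \<in> S \<Longrightarrow> z \<le> c s + (\<Sum>p\<in>Sigma V N. l p * g p s)" by blast
  \<comment> \<open>Each \<open>l (i, f)\<close> shifts weight from the reference face to
    \<open>f\<close>; the correction at \<open>base i\<close> restores the total
    \<open>\<theta>V i\<close>.\<close>
  define \<theta>F where "\<theta>F i f = l (i, f) + (if f = base i then \<theta>V i - (\<Sum>f\<in>N i. l (i, f)) else 0)" for i f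
  have sum_\<theta>F: "(\<Sum>f\<in>N i. \<theta>F i f * h f) = \<theta>V i * h (base i) + (\<Sum>f\<in>N i. l (i, f) * (h f - h (base i)))"
    if "i \<in> V" for i h
  proof -
    have "(\<Sum>f\<in>N i. \<theta>F i f * h f) = (\<Sum>f\<in>N i. l (i, f) * h f +
        (if f = base i then (\<theta>V i - (\<Sum>f\<in>N i. l (i, f))) * h f else 0))"
      by (rule sum.cong) (auto simp: \<theta>F_def algebra_simps)
    also have "\<dots> = (\<Sum>f\<in>N i. l (i, f) * h f) + (\<theta>V i - (\<Sum>f\<in>N i. l (i, f))) * h (base i)"
      using base_in[OF that] finite_sets(3) by (simp add: sum.distrib)
    finally show ?thesis
      by (simp add: algebra_simps sum_subtractf sum_distrib_left)
  qed
  show thesis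
  proof (rule that)
    show "feasible \<theta>F"
      unfolding pcc_feasible_def using sum_\<theta>F[of _ "\<lambda>_. 1"] by simp
    show "z \<le> min_pcc \<theta>F"
    proof (rule le_min_pcc)
      fix s assume s: "s \<in> S"
      have "(\<Sum>i\<in>V. \<Sum>f\<in>N i. \<theta>F i f * diff i f s) =
        (\<Sum>i\<in>V. \<theta>V i * diff i (base i) s + (\<Sum>f\<in>N i. l (i, f) * (diff i f s - diff i (base i) s)))"
        using sum_\<theta>F by simp
      also have "\<dots> = (\<Sum>i\<in>V. \<theta>V i * diff i (base i) s) + (\<Sum>p\<in>Sigma V N. l p * g p s)"
        using fin finite_sets(3) by (simp add: sum.distrib sum.Sigma g_def case_prod_unfold)
      finally show "z \<le> pcc_energy V E \<phi> \<gamma> \<theta>E \<theta>F (fst s) (snd s)"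
        unfolding pcc_energy_alt using l[OF s] by (simp add: c_def)
    qed
  qed
qed

text \<open>The all-zero labeling has energy 0 whatever the weights; this bounds the set of attained
  values from above.\<close>

lemma feasible_min_pcc_le_0: "min_pcc \<theta>F \<le> 0"
proof -
  define s where "s = ((\<lambda>_\<in>V. 0 :: nat), (\<lambda>_\<in>\<F>. 0 :: nat))"
  have "s \<in> S" by (auto simp: s_def S_def labelings_def)
  moreover have "pairwise_energy E \<theta>E (fst s) = 0"
    unfolding pairwise_energy_def
  proof (rule sum.neutral, rule ballI)
    fix e assume "e \<in> E"
    then have "e \<subseteq> V" using sg by (simp add: simple_graph_def)
    then have "fst s i = 0" if "i \<in> e" for i using that by (auto simp: s_def)
    then show "\<theta>E e * of_bool (\<exists>i\<in>e. \<exists>j\<in>e. fst s i \<noteq> fst s j) = 0" by simp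
  qed
  moreover have "diff i f s = 0" if "i \<in> V" "f \<in> N i" for i f
    using that by (auto simp: diff_def s_def incident_faces_def)
  ultimately show ?thesis
    using min_pcc_le[of s \<theta>F] unfolding pcc_energy_alt by simp
qed

text \<open>The supremum of the attained bounds lies below the cost of every consistent distribution,
  so by duality it is itself attained.\<close>

lemma min_pcc_le_bound:
  assumes "feasible \<theta>F"
  shows "min_pcc \<theta>F \<le> pcc_bound V E \<phi> \<gamma> \<theta>E \<theta>V"
proof -
  define Z where "Z = {z. \<exists>\<theta>F. feasible \<theta>F \<and> z = min_pcc \<theta>F}"
  have bdd: "bdd_above Z"
    unfolding bdd_above_def Z_def using feasible_min_pcc_le_0 by blast
  have in_Z: "min_pcc \<theta>F \<in> Z" if "feasible \<theta>F" for \<theta>F using that by (auto simp: Z_def)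
  obtain \<theta>F' where \<theta>F': "feasible \<theta>F'" "Sup Z \<le> min_pcc \<theta>F'"
  proof (rule pcc_duality)
    fix w assume "consistent w"
    then show "Sup Z \<le> cost w"
      using in_Z[OF assms] min_pcc_le_cost by (intro cSup_least) (auto simp: Z_def)
  qed
  have "pcc_bound V E \<phi> \<gamma> \<theta>E \<theta>V = Sup Z"
    unfolding pcc_bound_def
  proof (rule Greatest_equality)
    have "Sup Z = min_pcc \<theta>F'"
      using \<theta>F' cSup_upper[OF in_Z[OF \<theta>F'(1)] bdd] by simp
    then show "\<exists>\<theta>F. feasible \<theta>F \<and> Sup Z = min_pcc \<theta>F" using \<theta>F'(1) by blast
  next
    fix z assume "\<exists>\<theta>F. feasible \<theta>F \<and> z = min_pcc \<theta>F"
    then show "z \<le> Sup Z" using bdd by (intro cSup_upper) (auto simp: Z_def)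
  qed
  then show ?thesis using cSup_upper[OF in_Z[OF assms] bdd] by simp
qed

text \<open>Two adjacent vertices share a face, so the triangle formed with the auxiliary variable of that
  face makes their apex probabilities compatible with the probability that the edge is cut.\<close>

lemma consistent_cut_metric:
  assumes w: "consistent w"
  obtains D where "cut_metric V D (\<lambda>i. expect S w (diff i (base i)))"
    "\<And>e. e \<in> E \<Longrightarrow> D e = expect S w (\<lambda>s. of_bool (\<exists>i\<in>e. \<exists>j\<in>e. fst s i \<noteq> fst s j))"
proof -
  have pw: "prob_weights S w" using w by (simp add: consistent_def)
  define m where "m i = expect S w (diff i (base i))" for i
  define d where "d i j = expect S w (\<lambda>s. of_bool (fst s i \<noteq> fst s j))" for i j
  have m_eq: "expect S w (diff i f) = m i" if "i \<in> V" "f \<in> N i" for i f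
    using w that by (simp add: consistent_def m_def)
  have const: "a \<le> expect S w f" if "\<And>s. s \<in> S \<Longrightarrow> a \<le> f s" for a f
    using expect_mono[OF pw, of "\<lambda>_. a" f] that by (simp add: expect_const[OF pw])
  have const': "expect S w f \<le> a" if "\<And>s. s \<in> S \<Longrightarrow> f s \<le> a" for a f
    using expect_mono[OF pw, of f "\<lambda>_. a"] that by (simp add: expect_const[OF pw])
  have l01: "fst s i = 0 \<or> fst s i = 1" if "s \<in> S" "i \<in> V" for s i
    using that labelings_01[of "fst s" V i] by (auto simp: S_def)
  have f01: "snd s f = 0 \<or> snd s f = 1" if "s \<in> S" "f \<in> \<F>" for s f
    using that labelings_01[of "snd s" \<F> f] by (auto simp: S_def)
  have sym: "d i j = d j i" for i j by (simp add: d_def eq_commute)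
  have "cut_metric V (apex_clamp_edge m d) m"
  proof (rule cut_metric_apex_clamp[OF sym])
    show "d i i = 0" for i by (simp add: d_def expect_def)
    show "0 \<le> m i" "m i \<le> 1" for i
      unfolding m_def by (intro const const'; simp add: diff_def)+
    show "d i k \<le> d i j + d j k" if "i \<in> V" "j \<in> V" "k \<in> V" for i j k
      unfolding d_def expect_add[symmetric] by (intro expect_mono[OF pw]) auto
    show "d i j + d j k + d i k \<le> 2" if V: "i \<in> V" "j \<in> V" "k \<in> V" for i j k
      unfolding d_def expect_add[symmetric]
    proof (rule const')
      fix s assume "s \<in> S"
      from l01[OF this V(1)] l01[OF this V(2)] l01[OF this V(3)]
      show "of_bool (fst s i \<noteq> fst s j) + of_bool (fst s j \<noteq> fst s k) + of_bool (fst s i \<noteq> fst s k) \<le> (2 :: real)"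
        by (elim disjE) simp_all
    qed
  qed
  moreover have "apex_clamp_edge m d e = expect S w (\<lambda>s. of_bool (\<exists>i\<in>e. \<exists>j\<in>e. fst s i \<noteq> fst s j))"
    if e: "e \<in> E" for e
  proof -
    have "card e = 2" "e \<subseteq> V" using sg e by (auto simp: simple_graph_def)
    then obtain i j where ij: "e = {i, j}" "i \<in> V" "j \<in> V" by (auto simp: card_2_iff)
    obtain f where f: "f \<in> \<F>" "\<forall>i\<in>e. \<phi> i \<in> frontier f"
      by (rule edge_common_face[OF fin sg pe e])
    then have m: "m i = expect S w (diff i f)" "m j = expect S w (diff j f)"
      using ij by (simp_all add: m_eq incident_faces_def)
    have "m i \<le> d i j + m j" "m j \<le> d i j + m i" "d i j \<le> m i + m j"
      unfolding m d_def expect_add[symmetric] by (intro expect_mono[OF pw]; auto simp: diff_def)+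
    moreover have "d i j + m i + m j \<le> 2"
      unfolding m d_def expect_add[symmetric]
    proof (rule const')
      fix s assume "s \<in> S"
      from l01[OF this ij(2)] l01[OF this ij(3)] f01[OF this f(1)]
      show "of_bool (fst s i \<noteq> fst s j) + diff i f s + diff j f s \<le> 2"
        unfolding diff_def by (elim disjE) simp_all
    qed
    \<comment> \<open>On edges the clamping is inactive, so the cost can be read off from the
      clamped metric.\<close>
    ultimately have "apex_clamp m d i j = d i j"
      by (simp add: apex_clamp_def max_def min_def abs_if)
    moreover have "d i j = expect S w (\<lambda>s. of_bool (\<exists>i\<in>e. \<exists>j\<in>e. fst s i \<noteq> fst s j))"
      unfolding d_def ij(1) by (rule arg_cong[of _ _ "expect S w"]) auto
    moreover have "apex_clamp_edge m d {i, j} = apex_clamp m d i j"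
      by (rule apex_clamp_edge_eq[OF sym])
    ultimately show ?thesis using ij(1) by simp
  qed
  ultimately show thesis using that unfolding m_def by blast
qed

lemma cost_eq:
  assumes D: "\<And>e. e \<in> E \<Longrightarrow> D e = expect S w (\<lambda>s. of_bool (\<exists>i\<in>e. \<exists>j\<in>e. fst s i \<noteq> fst s j))"
  shows "cost w = (\<Sum>e\<in>E. \<theta>E e * D e) + (\<Sum>i\<in>V. \<theta>V i * expect S w (diff i (base i)))"
proof -
  have "expect S w (\<lambda>s. pairwise_energy E \<theta>E (fst s)) =
      (\<Sum>e\<in>E. \<theta>E e * expect S w (\<lambda>s. of_bool (\<exists>i\<in>e. \<exists>j\<in>e. fst s i \<noteq> fst s j)))"
    unfolding pairwise_energy_def expect_sum expect_cmult ..
  then show ?thesis using D by (simp add: cost_def)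
qed

end

text \<open>Since \<open>h\<close> is the same for all subproblems, interchanging the sums gathers
  the shares of each parameter.\<close>

lemma sum_decomposition:
  fixes \<theta> h :: "'x \<Rightarrow> real"
  assumes "finite T" "finite A" "\<And>t. t \<in> T \<Longrightarrow> At t \<subseteq> A"
    "\<And>x. x \<in> A \<Longrightarrow> (\<Sum>t | t \<in> T \<and> x \<in> At t. \<theta>t t x) = \<theta> x"
  shows "(\<Sum>t\<in>T. \<Sum>x\<in>At t. \<theta>t t x * h x) = (\<Sum>x\<in>A. \<theta> x * h x)"
proof -
  have "(\<Sum>t\<in>T. \<Sum>x\<in>At t. \<theta>t t x * h x) = (\<Sum>t\<in>T. \<Sum>x | x \<in> A \<and> x \<in> At t. \<theta>t t x * h x)"
    using assms(3) by (intro sum.cong refl) auto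
  also have "\<dots> = (\<Sum>x\<in>A. \<Sum>t | t \<in> T \<and> x \<in> At t. \<theta>t t x * h x)"
    using assms(1,2) by (rule sum.swap_restrict)
  also have "\<dots> = (\<Sum>x\<in>A. \<theta> x * h x)"
    using assms(4) by (intro sum.cong refl) (simp flip: sum_distrib_right)
  finally show ?thesis .
qed

theorem corollary5p4:
  fixes V :: "'v set" and E :: "'v set set"
    and \<phi> :: "'v \<Rightarrow> complex" and \<gamma> :: "'v set \<Rightarrow> real \<Rightarrow> complex"
    and \<theta>E :: "'v set \<Rightarrow> real" and \<theta>V :: "'v \<Rightarrow> real"
    and T :: "'t set" and Vt :: "'t \<Rightarrow> 'v set" and Et :: "'t \<Rightarrow> 'v set set"
    and \<theta>Et :: "'t \<Rightarrow> 'v set \<Rightarrow> real" and \<theta>Vt :: "'t \<Rightarrow> 'v \<Rightarrow> real"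
  assumes "finite V" and "simple_graph V E" and "planar_embedding V E \<phi> \<gamma>"
    and "finite T"
    and "\<And>t. t \<in> T \<Longrightarrow> subgraph (Vt t) (Et t) V E"
    and "\<And>t. t \<in> T \<Longrightarrow> outer_planar (Vt t) (Et t)"
    and "\<And>e. e \<in> E \<Longrightarrow> (\<Sum>t | t \<in> T \<and> e \<in> Et t. \<theta>Et t e) = \<theta>E e"
    and "\<And>i. i \<in> V \<Longrightarrow> (\<Sum>t | t \<in> T \<and> i \<in> Vt t. \<theta>Vt t i) = \<theta>V i"
  shows "(\<Sum>t\<in>T. min_energy (Vt t) (Et t) (\<theta>Et t) (\<theta>Vt t)) \<le> pcc_bound V E \<phi> \<gamma> \<theta>E \<theta>V"
proof -
  interpret pcc V E \<phi> \<gamma> \<theta>E \<theta>V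
    using assms(1-3) by unfold_locales
  obtain \<theta>F where \<theta>F: "feasible \<theta>F"
    "(\<Sum>t\<in>T. min_energy (Vt t) (Et t) (\<theta>Et t) (\<theta>Vt t)) \<le> min_pcc \<theta>F"
  \<comment> \<open>With the decomposition bound as \<open>z\<close>, it suffices to compare it with
    the cost of every consistent distribution, where one \<open>D\<close> and one \<open>m\<close>
    serve all subproblems.\<close>
  proof (rule pcc_duality)
    fix w assume w: "consistent w"
    define m where "m i = expect S w (diff i (base i))" for i
    obtain D where D: "cut_metric V D m"
      "\<And>e. e \<in> E \<Longrightarrow> D e = expect S w (\<lambda>s. of_bool (\<exists>i\<in>e. \<exists>j\<in>e. fst s i \<noteq> fst s j))"
      using consistent_cut_metric[OF w] unfolding m_def by blast
    have "min_energy (Vt t) (Et t) (\<theta>Et t) (\<theta>Vt t) \<le>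
        (\<Sum>e\<in>Et t. \<theta>Et t e * D e) + (\<Sum>i\<in>Vt t. \<theta>Vt t i * m i)" if t: "t \<in> T" for t
    proof -
      have sub: "simple_graph (Vt t) (Et t)" "Vt t \<subseteq> V"
        using assms(5)[OF t] by (auto simp: subgraph_def)
      then have finVt: "finite (Vt t)" using assms(1) finite_subset by blast
      obtain \<phi>' \<gamma>' U where "outer_drawn (Vt t) (Et t) \<phi>' \<gamma>' U"
        using outer_planar_imp_outer_drawn[OF assms(6)[OF t] sub(1)] .
      from outer_drawn_energy_bound[OF finVt this sub(2) D(1)]
      obtain X where "X \<in> labelings (Vt t)" "energy (Vt t) (Et t) (\<theta>Et t) (\<theta>Vt t) X \<le>
          (\<Sum>e\<in>Et t. \<theta>Et t e * D e) + (\<Sum>i\<in>Vt t. \<theta>Vt t i * m i)" by blast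
      then show ?thesis using min_energy_le[OF finVt] order_trans by blast
    qed
    then have "(\<Sum>t\<in>T. min_energy (Vt t) (Et t) (\<theta>Et t) (\<theta>Vt t)) \<le>
        (\<Sum>t\<in>T. (\<Sum>e\<in>Et t. \<theta>Et t e * D e) + (\<Sum>i\<in>Vt t. \<theta>Vt t i * m i))"
      by (rule sum_mono)
    also have "\<dots> = (\<Sum>e\<in>E. \<theta>E e * D e) + (\<Sum>i\<in>V. \<theta>V i * m i)"
      unfolding sum.distrib
      using sum_decomposition[OF assms(4) finite_sets(1) _ assms(7), of D]
        sum_decomposition[OF assms(4,1) _ assms(8), of m] assms(5)
      by (auto simp: subgraph_def)
    also have "\<dots> = cost w"
      unfolding m_def by (rule cost_eq[OF D(2), symmetric])
    finally show "(\<Sum>t\<in>T. min_energy (Vt t) (Et t) (\<theta>Et t) (\<theta>Vt t)) \<le> cost w" .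
  qed
  then show ?thesis using min_pcc_le_bound by fastforce
qed

end
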